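(* Let $C_1, C_2$ be real numbers with $C_1 \cdot C_2 \neq 0$, and let $\xi(s) = C_1 \xi^+(s) + C_2 \xi^-(s)$ be the corresponding linear combination of the Shintani zeta functions. Then $\xi(s)$ is not a finite sum of Euler products. That is, writing $\xi(s) = \sum_{n \geq 1} a(n) n^{-s}$, there do not exist a positive integer $k$, real numbers $c_1, \dots, c_k$, and multiplicative functions $b_1, \dots, b_k$ on the positive integers such that $a(n) = \sum_{i=1}^k c_i b_i(n)$ for all $n \geq 1$.
   Context: Let $V_{\mathbb{Z}} = \{ a u^3 + b u^2 v + c u v^2 + d v^3 : a,b,c,d \in \mathbb{Z}\}$ be the lattice of integral binary cubic forms. The discriminant of $f = a u^3 + b u^2 v + c u v^2 + d v^3$ is $\mathrm{Disc}(f) = b^2c^2 - 4ac^3 - 4b^3 d - 27 a^2 d^2 + 18abcd$. The group $\mathrm{GL}_2(\mathbb{Z})$ (and hence $\mathrm{SL}_2(\mathbb{Z})$) acts on $V_{\mathbb{Z}}$ by $(\gamma \cdot f)(u,v) = \frac{1}{\det \gamma} f((u,v)\cdot \gamma)$; this action preserves the discriminant. The Shintani zeta functions are the Dirichlet series $$\xi^{\pm}(s) = \sum_{\substack{x \in \mathrm{SL}_2(\mathbb{Z}) \backslash V_{\mathbb{Z}} \\ \pm \mathrm{Disc}(x) > 0}} \frac{1}{|\mathrm{Stab}(x)|}\, |\mathrm{Disc}(x)|^{-s},$$ where the sum is over $\mathrm{SL}_2(\mathbb{Z})$-orbits and $\mathrm{Stab}(x)$ is the stabilizer of (a representative of) $x$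 in $\mathrm{SL}_2(\mathbb{Z})$. A multiplicative function is a (complex-valued) function $b$ on the positive integers with $b(1) = 1$ and $b(mn) = b(m)b(n)$ whenever $\gcd(m,n)=1$. *)

theory Defs
  imports "HOL-Analysis.Analysis"
begin

datatype cubic_form = Cubic int int int int

fun eval_form :: "cubic_form \<Rightarrow> int ^ 2 \<Rightarrow> int" where
  "eval_form (Cubic a b c d) w =
     a * (w $ 1) ^ 3 + b * (w $ 1) ^ 2 * (w $ 2) + c * (w $ 1) * (w $ 2) ^ 2 + d * (w $ 2) ^ 3"

fun Disc :: "cubic_form \<Rightarrow> int" where
  "Disc (Cubic a b c d) =
     b^2 * c^2 - 4 * a * c^3 - 4 * b^3 * d - 27 * a^2 * d^2 + 18 * a * b * c * d"

definition SL2Z :: "(int ^ 2 ^ 2) set" where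
  "SL2Z = {\<gamma>. det \<gamma> = 1}"

text \<open>Coefficients of the form \<open>f((u,v) \<gamma>)\<close>, see \<open>eval_form_act\<close> below. Only matrices in
  \<open>SL2Z\<close> are used, for which the twist \<open>1 / det \<gamma>\<close> of the \<open>GL2\<close>-action is trivial.\<close>

fun act :: "int ^ 2 ^ 2 \<Rightarrow> cubic_form \<Rightarrow> cubic_form" where
  "act \<gamma> (Cubic a b c d) =
     (let p = \<gamma> $ 1 $ 1; q = \<gamma> $ 1 $ 2; r = \<gamma> $ 2 $ 1; s = \<gamma> $ 2 $ 2 in
      Cubic (a * p^3 + b * p^2 * q + c * p * q^2 + d * q^3)
            (3 * a * p^2 * r + b * (p^2 * s + 2 * p * q * r) + c * (2 * p * q * s + q^2 * r)
               + 3 * d * q^2 * s)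
            (3 * a * p * r^2 + b * (2 * p * r * s + q * r^2) + c * (p * s^2 + 2 * q * r * s)
               + 3 * d * q * s^2)
            (a * r^3 + b * r^2 * s + c * r * s^2 + d * s^3))"

lemma eval_form_act: "eval_form (act \<gamma> f) w = eval_form f (w v* \<gamma>)"
  by (cases f)
    (simp add: vector_matrix_mult_def sum_2 Let_def power2_eq_square power3_eq_cube algebra_simps)

lemma act_mult: "act \<gamma> (act \<delta> f) = act (\<gamma> ** \<delta>) f"
proof (cases f)
  case (Cubic a b c d)
  show ?thesis
    unfolding Cubic act.simps Let_def cubic_form.inject matrix_matrix_mult_def sum_2
    by (simp only: vec_lambda_beta) (intro conjI; algebra)
qed

lemma act_one: "act (mat 1) f = f"
  by (cases f) (simp add: mat_def)

lemma Disc_act: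
  assumes "\<gamma> \<in> SL2Z"
  shows "Disc (act \<gamma> f) = Disc f"
proof (cases f)
  case (Cubic a b c d)
  have "\<gamma> $ 1 $ 1 * \<gamma> $ 2 $ 2 - \<gamma> $ 1 $ 2 * \<gamma> $ 2 $ 1 = 1"
    using assms by (simp add: SL2Z_def det_2)
  moreover have "Disc (act \<gamma> f) =
    (\<gamma> $ 1 $ 1 * \<gamma> $ 2 $ 2 - \<gamma> $ 1 $ 2 * \<gamma> $ 2 $ 1) ^ 6 * Disc f"
    unfolding Cubic act.simps Let_def Disc.simps by algebra
  ultimately show ?thesis by simp
qed

definition Stab :: "cubic_form \<Rightarrow> (int ^ 2 ^ 2) set" where
  "Stab f = {\<gamma> \<in> SL2Z. act \<gamma> f = f}"

definition orbit :: "cubic_form \<Rightarrow> cubic_form set" where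
  "orbit f = (\<lambda>\<gamma>. act \<gamma> f) ` SL2Z"

definition orbit_rep :: "cubic_form set \<Rightarrow> cubic_form" where
  "orbit_rep X = (SOME f. f \<in> X)"

lemma SL2Z_mult: "\<gamma> \<in> SL2Z \<Longrightarrow> \<delta> \<in> SL2Z \<Longrightarrow> \<gamma> ** \<delta> \<in> SL2Z"
  by (simp add: SL2Z_def det_mul)

lemma SL2Z_inverse:
  assumes "\<gamma> \<in> SL2Z"
  obtains \<delta> where "\<delta> \<in> SL2Z" "\<gamma> ** \<delta> = mat 1" "\<delta> ** \<gamma> = mat 1"
proof
  let ?d = "vector [vector [\<gamma> $ 2 $ 2, - \<gamma> $ 1 $ 2], vector [- \<gamma> $ 2 $ 1, \<gamma> $ 1 $ 1]] :: int ^ 2 ^ 2"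
  have *: "\<gamma> $ 1 $ 1 * \<gamma> $ 2 $ 2 - \<gamma> $ 1 $ 2 * \<gamma> $ 2 $ 1 = 1"
    using assms by (simp add: SL2Z_def det_2)
  show "?d \<in> SL2Z" "\<gamma> ** ?d = mat 1" "?d ** \<gamma> = mat 1"
    using * by (auto simp: SL2Z_def det_2 vec_eq_iff forall_2 matrix_matrix_mult_def sum_2 mat_def
        algebra_simps)
qed

lemma orbit_rep_act:
  obtains \<gamma> where "\<gamma> \<in> SL2Z" "orbit_rep (orbit f) = act \<gamma> f"
proof -
  have "mat 1 \<in> SL2Z" by (simp add: SL2Z_def)
  then have "\<exists>g. g \<in> orbit f" unfolding orbit_def by blast
  then have "orbit_rep (orbit f) \<in> orbit f"
    unfolding orbit_rep_def by (rule someI_ex)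
  then show ?thesis using that unfolding orbit_def by blast
qed

lemma card_Stab_act:
  assumes "\<gamma> \<in> SL2Z"
  shows "card (Stab (act \<gamma> f)) = card (Stab f)"
proof -
  obtain \<delta> where \<delta>: "\<delta> \<in> SL2Z" "\<gamma> ** \<delta> = mat 1" "\<delta> ** \<gamma> = mat 1"
    using SL2Z_inverse assms by blast
  have c: "\<delta> ** (\<gamma> ** x) = x" "\<gamma> ** (\<delta> ** x) = x" for x :: "int ^ 2 ^ 2"
    using \<delta> by (simp_all add: matrix_mul_assoc)
  have "bij_betw (\<lambda>x. \<gamma> ** (x ** \<delta>)) (Stab f) (Stab (act \<gamma> f))"
  proof (rule bij_betw_byWitness[where f' = "\<lambda>x. \<delta> ** (x ** \<gamma>)"])
    show "\<forall>x\<in>Stab f. \<delta> ** (\<gamma> ** (x ** \<delta>) ** \<gamma>) = x"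
      "\<forall>x\<in>Stab (act \<gamma> f). \<gamma> ** (\<delta> ** (x ** \<gamma>) ** \<delta>) = x"
      using \<delta> c by (simp_all flip: matrix_mul_assoc)
    have *: "act (\<gamma> ** (x ** \<delta>)) (act \<gamma> f) = act \<gamma> (act x f)" for x
      by (simp add: act_mult \<delta> flip: matrix_mul_assoc)
    have **: "act (\<delta> ** (x ** \<gamma>)) f = act \<delta> (act x (act \<gamma> f))" for x
      by (simp add: act_mult)
    have ***: "act \<delta> (act \<gamma> f) = f"
      by (simp add: act_mult act_one \<delta>)
    show "(\<lambda>x. \<gamma> ** (x ** \<delta>)) ` Stab f \<subseteq> Stab (act \<gamma> f)"
      using * assms \<delta> by (auto simp: Stab_def intro!: SL2Z_mult)
    show "(\<lambda>x. \<delta> ** (x ** \<gamma>)) ` Stab (act \<gamma> f) \<subseteq> Stab f"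
      using ** *** assms \<delta> by (auto simp: Stab_def intro!: SL2Z_mult)
  qed
  then show ?thesis by (metis bij_betw_same_card)
qed

lemma orbit_rep_invariants:
  "Disc (orbit_rep (orbit f)) = Disc f"
  "card (Stab (orbit_rep (orbit f))) = card (Stab f)"
  by (metis orbit_rep_act Disc_act) (metis orbit_rep_act card_Stab_act)

text \<open>The sign is \<open>1\<close> for \<open>\<xi>\<^sup>+\<close> and \<open>-1\<close> for \<open>\<xi>\<^sup>-\<close>.\<close>

definition shintani_orbits :: "int \<Rightarrow> cubic_form set set" where
  "shintani_orbits \<sigma> = {X \<in> range orbit. \<sigma> * Disc (orbit_rep X) > 0}"

definition shintani_zeta :: "int \<Rightarrow> complex \<Rightarrow> complex" where
  "shintani_zeta \<sigma> s =
     (\<Sum>\<^sub>\<infinity>X\<in>shintani_orbits \<sigma>. (1 / of_nat (card (Stab (orbit_rep X)))) *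
        of_int \<bar>Disc (orbit_rep X)\<bar> powr (- s))"

text \<open>The \<open>n\<close>-th coefficient of the Dirichlet series \<open>\<xi>\<^sup>\<plusminus>\<close>, obtained by collecting its terms
  with \<open>|Disc(x)| = n\<close> (see \<open>shintani_zeta_eq_Dirichlet\<close> below). By reduction theory there are
  only finitely many such orbits when \<open>n > 0\<close>, and their stabilizers are finite.\<close>

definition shintani_coeff :: "int \<Rightarrow> nat \<Rightarrow> real" where
  "shintani_coeff \<sigma> n =
     (\<Sum>\<^sub>\<infinity>X\<in>{X \<in> shintani_orbits \<sigma>. \<bar>Disc (orbit_rep X)\<bar> = int n}.
        1 / real (card (Stab (orbit_rep X))))"

lemma infsum_complex_of_real: "(\<Sum>\<^sub>\<infinity>x\<in>A. complex_of_real (g x)) = of_real (infsum g A)"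
  by (intro infsum_bounded_linear_strong bounded_linear_of_real
      summable_on_bounded_linear_iff[OF bounded_linear_of_real bounded_linear_Re]) simp

lemma shintani_zeta_eq_Dirichlet:
  assumes "(\<lambda>X. (1 / of_nat (card (Stab (orbit_rep X)))) *
        of_int \<bar>Disc (orbit_rep X)\<bar> powr (- s) :: complex) summable_on shintani_orbits \<sigma>"
  shows "((\<lambda>n. of_real (shintani_coeff \<sigma> n) * of_nat n powr (- s)) has_sum shintani_zeta \<sigma> s) {1..}"
proof -
  let ?f = "\<lambda>X. (1 / of_nat (card (Stab (orbit_rep X)))) *
        of_int \<bar>Disc (orbit_rep X)\<bar> powr (- s) :: complex"
  let ?B = "\<lambda>n. {X \<in> shintani_orbits \<sigma>. \<bar>Disc (orbit_rep X)\<bar> = int n}"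
  have img: "snd ` Sigma {1..} ?B = shintani_orbits \<sigma>"
  proof (intro equalityI subsetI)
    fix X assume X: "X \<in> shintani_orbits \<sigma>"
    let ?n = "nat \<bar>Disc (orbit_rep X)\<bar>"
    have "Disc (orbit_rep X) \<noteq> 0" using X by (auto simp: shintani_orbits_def)
    then have "(?n, X) \<in> Sigma {1..} ?B" using X by auto
    then show "X \<in> snd ` Sigma {1..} ?B" by force
  qed auto
  have inj: "inj_on snd (Sigma {1..} ?B)" by (auto simp: inj_on_def)
  have sS: "(\<lambda>(n, X). ?f X) summable_on Sigma {1..} ?B"
    using assms summable_on_reindex[OF inj, of ?f] unfolding img
    by (simp add: o_def case_prod_unfold)
  have inner: "infsum ?f (?B n) = of_real (shintani_coeff \<sigma> n) * of_nat n powr (- s)" for n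
  proof -
    have "infsum ?f (?B n) = (\<Sum>\<^sub>\<infinity>X\<in>?B n.
        of_real (1 / real (card (Stab (orbit_rep X)))) * of_nat n powr (- s))"
      by (rule infsum_cong) (simp flip: of_int_abs)
    also have "\<dots> = (\<Sum>\<^sub>\<infinity>X\<in>?B n. of_real (1 / real (card (Stab (orbit_rep X))))) *
        of_nat n powr (- s)"
      by (rule infsum_cmult_left')
    finally show ?thesis
      unfolding shintani_coeff_def infsum_complex_of_real .
  qed
  have "infsum (\<lambda>n. infsum ?f (?B n)) {1..} = infsum (\<lambda>(n, X). ?f X) (Sigma {1..} ?B)"
    by (rule infsum_Sigma'_banach[OF sS])
  also have "\<dots> = shintani_zeta \<sigma> s"
    using infsum_reindex[OF inj, of ?f] unfolding img shintani_zeta_def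
    by (simp add: o_def case_prod_unfold)
  finally have "infsum (\<lambda>n. infsum ?f (?B n)) {1..} = shintani_zeta \<sigma> s" .
  moreover have "(\<lambda>n. infsum ?f (?B n)) summable_on {1..}"
    by (rule summable_on_Sigma_banach[OF sS])
  ultimately show ?thesis
    unfolding inner using has_sum_infsum by fastforce
qed

definition xi_coeff :: "real \<Rightarrow> real \<Rightarrow> nat \<Rightarrow> real" where
  "xi_coeff C1 C2 n = C1 * shintani_coeff 1 n + C2 * shintani_coeff (-1) n"

text \<open>The value at \<open>0\<close> is irrelevant.\<close>

definition multiplicative :: "(nat \<Rightarrow> complex) \<Rightarrow> bool" where
  "multiplicative b \<longleftrightarrow>
     b 1 = 1 \<and> (\<forall>m n. m > 0 \<longrightarrow> n > 0 \<longrightarrow> coprime m n \<longrightarrow> b (m * n) = b m * b n)"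

end

theory Submission
  imports Defs "HOL-Number_Theory.Cong"
begin

text \<open>
  If the coefficients \<open>a\<close> are a sum of \<open>k\<close> multiplicative functions, every matrix \<open>a (m\<^sub>i n\<^sub>j)\<close> with
  \<open>m\<^sub>i\<close> coprime to \<open>n\<^sub>j\<close> has rank at most \<open>k\<close>. Only indices congruent to 5 mod 8 are used; there
  negative discriminants do not contribute and \<open>a n\<close> is \<open>C1\<close> times the weighted number \<open>h n\<close> of
  classes of discriminant \<open>n\<close>.

  Let \<open>p > 3\<close> be a prime modulo which \<open>-3\<close> is a square. If \<open>D\<close> is a nonresidue mod \<open>p\<close>, then
  \<open>h (D p\<^sup>2) = h D\<close>: every form of discriminant \<open>D\<close> has exactly one root mod \<open>p\<close>, hence exactly
  one subform of index \<open>p\<close>, and there is no form of discriminant \<open>D p\<^sup>2\<close> that is maximal at \<open>p\<close>,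
  since it would be totally ramified and \<open>D\<close> would be \<open>-3\<close> times a square mod \<open>p\<close>. If instead
  \<open>D\<close> is a square modulo each of \<open>r\<close> such primes with product \<open>P\<close>, then the reducible forms alone
  give \<open>h (D P\<^sup>2) \<ge> r\<close>, which exceeds \<open>h D\<close> for large \<open>r\<close>. Choosing alternately discriminants
  \<open>D\<^sub>i\<close>, nonresidues modulo all primes used before, and products \<open>P\<^sub>i\<close> of primes modulo which
  \<open>D\<^sub>i\<close> is a square, the matrix \<open>h (D\<^sub>i P\<^sub>j\<^sup>2) - h D\<^sub>i\<close> is triangular with nonzero diagonal, of
  arbitrary size.
\<close>

subsection \<open>Orbits and their weights\<close>

definition mat2 :: "int \<Rightarrow> int \<Rightarrow> int \<Rightarrow> int \<Rightarrow> int ^ 2 ^ 2" where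
  "mat2 p q r s = vector [vector [p, q], vector [r, s]]"

lemma mat2_sel [simp]:
  "mat2 p q r s $ 1 $ 1 = p" "mat2 p q r s $ 1 $ 2 = q"
  "mat2 p q r s $ 2 $ 1 = r" "mat2 p q r s $ 2 $ 2 = s"
  by (simp_all add: mat2_def)

lemma mat2_eta [simp]: "mat2 (\<gamma> $ 1 $ 1) (\<gamma> $ 1 $ 2) (\<gamma> $ 2 $ 1) (\<gamma> $ 2 $ 2) = \<gamma>"
  by (simp add: mat2_def vec_eq_iff forall_2)

lemma mat2_cases: obtains p q r s where "\<gamma> = mat2 p q r s"
  by (metis mat2_eta)

lemma mat2_eq_iff [simp]:
  "mat2 p q r s = mat2 p' q' r' s' \<longleftrightarrow> p = p' \<and> q = q' \<and> r = r' \<and> s = s'"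
  by (metis mat2_sel)

lemma mat_1_eq_mat2: "mat 1 = mat2 1 0 0 1"
  by (simp add: mat2_def vec_eq_iff forall_2 mat_def)

lemma mat2_in_SL2Z [simp]: "mat2 p q r s \<in> SL2Z \<longleftrightarrow> p * s - q * r = 1"
  by (simp add: SL2Z_def det_2)

lemma act_mat2 [simp]:
  "act (mat2 p q r s) (Cubic a b c d) =
     Cubic (a * p^3 + b * p^2 * q + c * p * q^2 + d * q^3)
           (3 * a * p^2 * r + b * (p^2 * s + 2 * p * q * r) + c * (2 * p * q * s + q^2 * r)
              + 3 * d * q^2 * s)
           (3 * a * p * r^2 + b * (2 * p * r * s + q * r^2) + c * (p * s^2 + 2 * q * r * s)
              + 3 * d * q * s^2)
           (a * r^3 + b * r^2 * s + c * r * s^2 + d * s^3)"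
  by (simp add: Let_def)

declare act.simps [simp del]

lemma one_in_SL2Z: "mat 1 \<in> SL2Z"
  by (simp add: SL2Z_def)

lemma orbit_self: "f \<in> orbit f"
  unfolding orbit_def by (rule image_eqI[OF _ one_in_SL2Z]) (simp add: act_one)

lemma orbit_act:
  assumes "\<gamma> \<in> SL2Z"
  shows "orbit (act \<gamma> f) = orbit f"
proof -
  obtain \<delta> where \<delta>: "\<delta> \<in> SL2Z" "\<delta> ** \<gamma> = mat 1"
    using SL2Z_inverse assms by metis
  have "act \<alpha> (act \<gamma> f) \<in> orbit f" if "\<alpha> \<in> SL2Z" for \<alpha>
    using that assms by (simp add: act_mult orbit_def SL2Z_mult)
  moreover have "act \<alpha> f \<in> orbit (act \<gamma> f)" if "\<alpha> \<in> SL2Z" for \<alpha>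
  proof -
    have "act (\<alpha> ** \<delta>) (act \<gamma> f) = act \<alpha> f"
      using \<delta> by (simp add: act_mult flip: matrix_mul_assoc)
    then show ?thesis
      unfolding orbit_def by (intro image_eqI[OF _ SL2Z_mult[OF that \<delta>(1)]]) simp
  qed
  ultimately show ?thesis by (auto simp: orbit_def)
qed

text \<open>Bijections between such sets compare both equivalence of forms, through nonemptiness,
  and stabilizer sizes, by taking equal arguments.\<close>

definition transporter :: "cubic_form \<Rightarrow> cubic_form \<Rightarrow> (int ^ 2 ^ 2) set" where
  "transporter f g = {\<gamma> \<in> SL2Z. act \<gamma> f = g}"

lemma Stab_eq_transporter: "Stab f = transporter f f"
  by (simp add: Stab_def transporter_def)

lemma orbit_eq_iff: "orbit f = orbit g \<longleftrightarrow> transporter f g \<noteq> {}"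
proof
  assume "orbit f = orbit g"
  then have "g \<in> orbit f" using orbit_self by simp
  then show "transporter f g \<noteq> {}" by (auto simp: orbit_def transporter_def)
next
  assume "transporter f g \<noteq> {}"
  then show "orbit f = orbit g" using orbit_act by (auto simp: transporter_def)
qed

definition orbit_weight :: "cubic_form set \<Rightarrow> real" where
  "orbit_weight X = 1 / real (card (Stab (orbit_rep X)))"

lemma orbit_weight_orbit: "orbit_weight (orbit f) = 1 / real (card (Stab f))"
  by (simp add: orbit_weight_def orbit_rep_invariants)

definition orbits_of_disc :: "int \<Rightarrow> cubic_form set set" where
  "orbits_of_disc D = orbit ` {f. Disc f = D}"

lemma shintani_coeff_eq:
  assumes "n > 0"
  shows "shintani_coeff 1 n = infsum orbit_weight (orbits_of_disc (int n))"
    "shintani_coeff (-1) n = infsum orbit_weight (orbits_of_disc (- int n))"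
proof -
  have "{X \<in> shintani_orbits 1. \<bar>Disc (orbit_rep X)\<bar> = int n} = orbits_of_disc (int n)"
    "{X \<in> shintani_orbits (-1). \<bar>Disc (orbit_rep X)\<bar> = int n} = orbits_of_disc (- int n)"
    using assms by (auto simp: shintani_orbits_def orbits_of_disc_def orbit_rep_invariants)
  then show "shintani_coeff 1 n = infsum orbit_weight (orbits_of_disc (int n))"
    "shintani_coeff (-1) n = infsum orbit_weight (orbits_of_disc (- int n))"
    by (simp_all add: shintani_coeff_def orbit_weight_def[abs_def])
qed

text \<open>Modulo 4 the discriminant is the square of \<open>b * c + d * a\<close>.\<close>

lemma Disc_mod_4: "Disc f mod 4 \<in> {0, 1}"
proof (cases f)
  case (Cubic a b c d)
  have "Disc f = (b * c + d * a) ^ 2 + 4 * (- a * c^3 - b^3 * d - 7 * a^2 * d^2 + 4 * a * b * c * d)"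
    unfolding Cubic Disc.simps by (simp add: power2_eq_square algebra_simps)
  then have "Disc f mod 4 = (b * c + d * a) ^ 2 mod 4" by (simp only: mod_mult_self2)
  moreover have "x ^ 2 mod 4 \<in> {0, 1}" for x :: int
  proof (cases "even x")
    case True
    then show ?thesis by (auto elim!: evenE simp: power2_eq_square)
  next
    case False
    then obtain k where "x = 2 * k + 1" by (elim oddE)
    then have "x ^ 2 = 4 * (k * k + k) + 1" by (simp add: power2_eq_square algebra_simps)
    then show ?thesis by (simp only: mod_mult_self4) simp
  qed
  ultimately show ?thesis by simp
qed

text \<open>Since \<open>- int n\<close> is 3 modulo 4, it is not a discriminant, and the
  \<open>C2\<close> part vanishes.\<close>

lemma xi_coeff_1_mod_4:
  assumes "n mod 4 = 1"
  shows "xi_coeff C1 C2 n = C1 * infsum orbit_weight (orbits_of_disc (int n))"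
proof -
  have "n > 0" using assms by (cases n) auto
  moreover have "orbits_of_disc (- int n) = {}"
  proof -
    have "int n mod 4 = 1" using assms by (metis of_nat_1 of_nat_mod of_nat_numeral)
    then have "(- int n) mod 4 = 3" by presburger
    then have "Disc f \<noteq> - int n" for f using Disc_mod_4[of f] by auto
    then show ?thesis by (simp add: orbits_of_disc_def)
  qed
  ultimately show ?thesis by (simp add: xi_coeff_def shintani_coeff_eq)
qed

subsection \<open>Forms modulo a prime\<close>

text \<open>The case \<open>x = 0\<close> excludes multiples of \<open>p\<close>, so 0 does not
  count as a nonresidue.\<close>

definition nonresidue :: "int \<Rightarrow> int \<Rightarrow> bool" where
  "nonresidue p D \<longleftrightarrow> (\<forall>x. \<not> p dvd x ^ 2 - D)"

lemma prime_inverse_int: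
  fixes p :: int
  assumes "prime p" "\<not> p dvd a"
  obtains i where "p dvd a * i - 1"
proof -
  have "coprime a p" using assms by (metis coprime_commute prime_imp_coprime)
  then obtain i where "[a * i = 1] (mod p)" using cong_solve_coprime_int by blast
  then show ?thesis using that by (simp add: cong_iff_dvd_diff)
qed

text \<open>The norm form \<open>x^2 - D * y^2\<close> is anisotropic modulo \<open>p\<close>: were
  \<open>y\<close> invertible, \<open>x / y\<close> would be a square root of
  \<open>D\<close>.\<close>

lemma nonresidue_dvd:
  assumes "prime p" "nonresidue p D" "p dvd x ^ 2 - D * y ^ 2"
  shows "p dvd y"
proof (rule ccontr)
  assume "\<not> p dvd y"
  then obtain i where i: "p dvd y * i - 1" using prime_inverse_int assms(1) by blast
  have "(x * i) ^ 2 - D = (x ^ 2 - D * y ^ 2) * i ^ 2 + (y * i - 1) * ((y * i + 1) * D)"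
    by algebra
  then have "p dvd (x * i) ^ 2 - D" using assms(3) i by simp
  then show False using assms(2) by (simp add: nonresidue_def)
qed

lemma nonresidue_not_dvd: "nonresidue p D \<Longrightarrow> \<not> p dvd D"
  unfolding nonresidue_def by (metis dvd_minus_iff diff_0 zero_power2)

text \<open>The form \<open>(a, b, p c, p\<^sup>2 d)\<close> is the restriction of \<open>(p a, b, c, d)\<close> to a sublattice of index
  \<open>p\<close>, divided by \<open>p\<close>; the two group elements are conjugate by the corresponding diagonal matrix.\<close>

lemma transporter_rescale:
  fixes p :: int
  assumes "p \<noteq> 0"
  shows "act (mat2 x (p * y) z w) (Cubic (p * a) b c d) = Cubic (p * a') b' c' d' \<longleftrightarrow>
    act (mat2 x y (p * z) w) (Cubic a b (p * c) (p^2 * d)) = Cubic a' b' (p * c') (p^2 * d')"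
proof -
  have *: "A = p * a' \<longleftrightarrow> A' = a'" if "A = p * A'" for A A' a' :: int
    using that assms by simp
  have **: "A = a' \<longleftrightarrow> A' = p * a'" if "A' = p * A" for A A' a' :: int
    using that assms by simp
  have ***: "A = a' \<longleftrightarrow> A' = p^2 * a'" if "A' = p^2 * A" for A A' a' :: int
    using that assms by simp
  show ?thesis
    unfolding act_mat2 cubic_form.inject
  proof (intro arg_cong2[where f = "(\<and>)"])
    show "p * a * x^3 + b * x^2 * (p * y) + c * x * (p * y)^2 + d * (p * y)^3 = p * a' \<longleftrightarrow>
        a * x^3 + b * x^2 * y + p * c * x * y^2 + p^2 * d * y^3 = a'"
      by (rule *) algebra
    show "3 * (p * a) * x^2 * z + b * (x^2 * w + 2 * x * (p * y) * z)
          + c * (2 * x * (p * y) * w + (p * y)^2 * z) + 3 * d * (p * y)^2 * w = b' \<longleftrightarrow>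
        3 * a * x^2 * (p * z) + b * (x^2 * w + 2 * x * y * (p * z))
          + p * c * (2 * x * y * w + y^2 * (p * z)) + 3 * (p^2 * d) * y^2 * w = b'"
      by (rule arg_cong2[where f = "(=)", OF _ refl]) algebra
    show "3 * (p * a) * x * z^2 + b * (2 * x * z * w + (p * y) * z^2)
          + c * (x * w^2 + 2 * (p * y) * z * w) + 3 * d * (p * y) * w^2 = c' \<longleftrightarrow>
        3 * a * x * (p * z)^2 + b * (2 * x * (p * z) * w + y * (p * z)^2)
          + p * c * (x * w^2 + 2 * y * (p * z) * w) + 3 * (p^2 * d) * y * w^2 = p * c'"
      by (rule **) algebra
    show "p * a * z^3 + b * z^2 * w + c * z * w^2 + d * w^3 = d' \<longleftrightarrow>
        a * (p * z)^3 + b * (p * z)^2 * w + p * c * (p * z) * w^2 + p^2 * d * w^3 = p^2 * d'"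
      by (rule ***) algebra
  qed
qed

text \<open>The row \<open>(x, y)\<close> is a root of the form modulo \<open>p\<close>, as is
  \<open>(1, 0)\<close>. If \<open>y\<close> were invertible, it would be a root of the cofactor
  \<open>b * u^2 + c * u * v + d * v^2\<close>, whose discriminant times \<open>b^2\<close> is
  \<open>Disc\<close> modulo \<open>p\<close>, a nonresidue.\<close>

lemma root_unique:
  assumes "prime p" "nonresidue p (Disc (Cubic (p * a) b c d))"
    and "act (mat2 x y z w) (Cubic (p * a) b c d) = Cubic (p * a') b' c' d'"
  shows "p dvd y"
proof (rule ccontr)
  assume y: "\<not> p dvd y"
  let ?q = "b * x^2 + c * x * y + d * y^2"
  have "p * a * x^3 + y * ?q = p * a'"
    using assms(3) by (simp add: algebra_simps power2_eq_square power3_eq_cube)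
  then have "p dvd y * ?q" by (metis dvd_add_right_iff dvd_triv_left mult.assoc)
  then have "p dvd ?q" using y assms(1) prime_dvd_mult_iff by blast
  moreover have "(b * (2 * b * x + c * y))^2 - Disc (Cubic (p * a) b c d) * y^2
      = 4 * b^3 * ?q + p * ((4 * a * c^3 + 27 * p * a^2 * d^2 - 18 * a * b * c * d) * y^2)"
    by (simp; algebra)
  ultimately have "p dvd (b * (2 * b * x + c * y))^2 - Disc (Cubic (p * a) b c d) * y^2"
    by simp
  then show False using nonresidue_dvd assms(1,2) y by blast
qed

text \<open>Modulo \<open>p\<close> the form \<open>(a, b, p c, p^2 d)\<close> is
  \<open>u^2 * (a * u + b * v)\<close>. If \<open>z\<close> were invertible, the linear factor would
  vanish on both rows of the matrix. As the determinant is 1, \<open>p\<close> would divide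
  \<open>a\<close> and \<open>b\<close>, hence \<open>Disc\<close>.\<close>

lemma double_root_unique:
  fixes p :: int
  assumes "prime p" "\<not> p dvd Disc (Cubic (p * a) b c d)" "x * w - y * z = 1"
    and "act (mat2 x y z w) (Cubic a b (p * c) (p^2 * d)) = Cubic a' b' (p * c') (p^2 * d')"
  shows "p dvd z"
proof (rule ccontr)
  assume z: "\<not> p dvd z"
  have c': "3 * a * x * z^2 + b * (2 * x * z * w + y * z^2) + p * c * (x * w^2 + 2 * y * z * w)
      + 3 * (p^2 * d) * y * w^2 = p * c'"
    and d': "a * z^3 + b * z^2 * w + p * c * z * w^2 + p^2 * d * w^3 = p^2 * d'"
    using assms(4) by simp_all
  from d' have "z * (z * (a * z + b * w)) = p * (p * d' - (c * z * w^2 + p * d * w^3))"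
    by algebra
  then have "p dvd z * (z * (a * z + b * w))" by simp
  then have 1: "p dvd a * z + b * w" using z assms(1) by (simp add: prime_dvd_mult_iff)
  from c' have "z * (z * (a * x + b * y))
      = p * (c' - (c * (x * w^2 + 2 * y * z * w) + 3 * p * d * y * w^2))
        - (a * z + b * w) * (2 * x * z)"
    by algebra
  then have "p dvd z * (z * (a * x + b * y))" using 1 by simp
  then have 2: "p dvd a * x + b * y" using z assms(1) by (simp add: prime_dvd_mult_iff)
  have "b = x * (a * z + b * w) - z * (a * x + b * y)" "a = w * (a * x + b * y) - y * (a * z + b * w)"
    using assms(3) by algebra+
  then have "p dvd b" "p dvd a" using 1 2 by (metis dvd_diff dvd_mult)+
  then have "p dvd Disc (Cubic (p * a) b c d)" by (simp add: power2_eq_square power3_eq_cube)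
  then show False using assms(2) by simp
qed

text \<open>Conjugation by the diagonal matrix is integral in both directions:
  \<open>root_unique\<close> makes the upper right entry divisible by \<open>p\<close> on one side,
  \<open>double_root_unique\<close> the lower left entry on the other.\<close>

lemma bij_transporter:
  fixes p :: int
  assumes p: "prime p" and nr: "nonresidue p (Disc (Cubic (p * a) b c d))"
  shows "bij_betw (\<lambda>\<gamma>. mat2 (\<gamma> $ 1 $ 1) (\<gamma> $ 1 $ 2 div p) (p * (\<gamma> $ 2 $ 1)) (\<gamma> $ 2 $ 2))
    (transporter (Cubic (p * a) b c d) (Cubic (p * a') b' c' d'))
    (transporter (Cubic a b (p * c) (p^2 * d)) (Cubic a' b' (p * c') (p^2 * d')))"
    (is "bij_betw ?h ?T ?T'")
proof (rule bij_betw_byWitness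
    [where f' = "\<lambda>\<gamma>. mat2 (\<gamma> $ 1 $ 1) (p * (\<gamma> $ 1 $ 2)) (\<gamma> $ 2 $ 1 div p) (\<gamma> $ 2 $ 2)"])
  have p0: "p \<noteq> 0" using p by auto
  have T: "\<exists>x y z w. \<gamma> = mat2 x (p * y) z w \<and> x * w - p * y * z = 1 \<and>
      act (mat2 x y (p * z) w) (Cubic a b (p * c) (p^2 * d)) = Cubic a' b' (p * c') (p^2 * d')"
    if "\<gamma> \<in> ?T" for \<gamma>
  proof (cases \<gamma> rule: mat2_cases)
    case (1 x y z w)
    then have *: "x * w - y * z = 1"
        "act (mat2 x y z w) (Cubic (p * a) b c d) = Cubic (p * a') b' c' d'"
      using that by (auto simp: transporter_def)
    then obtain y' where "y = p * y'" using root_unique[OF p nr] by (meson dvdE)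
    with 1 * have "\<gamma> = mat2 x (p * y') z w" "x * w - p * y' * z = 1"
        "act (mat2 x (p * y') z w) (Cubic (p * a) b c d) = Cubic (p * a') b' c' d'"
      by (simp_all del: act_mat2)
    then show ?thesis using transporter_rescale[OF p0, THEN iffD1] by blast
  qed
  have T': "\<exists>x y z w. \<gamma> = mat2 x y (p * z) w \<and> x * w - p * y * z = 1 \<and>
      act (mat2 x (p * y) z w) (Cubic (p * a) b c d) = Cubic (p * a') b' c' d'"
    if "\<gamma> \<in> ?T'" for \<gamma>
  proof (cases \<gamma> rule: mat2_cases)
    case (1 x y z w)
    then have *: "x * w - y * z = 1"
        "act (mat2 x y z w) (Cubic a b (p * c) (p^2 * d)) = Cubic a' b' (p * c') (p^2 * d')"
      using that by (auto simp: transporter_def)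
    then obtain z' where "z = p * z'"
      using double_root_unique[OF p nonresidue_not_dvd[OF nr]] by (meson dvdE)
    with 1 * have "\<gamma> = mat2 x y (p * z') w" "x * w - p * y * z' = 1"
        "act (mat2 x y (p * z') w) (Cubic a b (p * c) (p^2 * d)) = Cubic a' b' (p * c') (p^2 * d')"
      by (simp_all add: mult_ac del: act_mat2)
    then show ?thesis using transporter_rescale[OF p0, THEN iffD2] by blast
  qed
  show "\<forall>\<gamma>\<in>?T. mat2 (?h \<gamma> $ 1 $ 1) (p * (?h \<gamma> $ 1 $ 2)) (?h \<gamma> $ 2 $ 1 div p) (?h \<gamma> $ 2 $ 2) = \<gamma>"
    using T p0 by force
  show "\<forall>\<gamma>\<in>?T'. ?h (mat2 (\<gamma> $ 1 $ 1) (p * (\<gamma> $ 1 $ 2)) (\<gamma> $ 2 $ 1 div p) (\<gamma> $ 2 $ 2)) = \<gamma>"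
    using T' p0 by force
  show "?h ` ?T \<subseteq> ?T'"
  proof clarify
    fix \<gamma> assume "\<gamma> \<in> ?T"
    from T[OF this] show "?h \<gamma> \<in> ?T'"
      using p0 by (auto simp: transporter_def mult_ac simp del: act_mat2)
  qed
  show "(\<lambda>\<gamma>. mat2 (\<gamma> $ 1 $ 1) (p * (\<gamma> $ 1 $ 2)) (\<gamma> $ 2 $ 1 div p) (\<gamma> $ 2 $ 2)) ` ?T' \<subseteq> ?T"
  proof clarify
    fix \<gamma> assume "\<gamma> \<in> ?T'"
    from T'[OF this] show "mat2 (\<gamma> $ 1 $ 1) (p * (\<gamma> $ 1 $ 2)) (\<gamma> $ 2 $ 1 div p) (\<gamma> $ 2 $ 2) \<in> ?T"
      using p0 by (auto simp: transporter_def mult_ac simp del: act_mat2)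
  qed
qed

text \<open>Let \<open>H\<close> be the Hessian of \<open>f\<close> and \<open>g\<close> the Jacobian of \<open>f\<close> and \<open>H\<close>. The identities \<open>coll\<close> and
  \<open>coll_infinity\<close> make \<open>[g : f]\<close> injective on the projective line over the field with \<open>p\<close>
  elements, as \<open>Disc f\<close> is a nonresidue. If \<open>f\<close> had no root, \<open>g / f\<close> would map its \<open>p + 1\<close>
  points injectively into \<open>p\<close> values.\<close>

lemma cubic_root_exists_if_nonresidue:
  assumes p: "prime p" "p > 2" and nr: "nonresidue p (Disc (Cubic a b c d))" and a: "\<not> p dvd a"
  shows "\<exists>t. p dvd a*t^3 + b*t^2 + c*t + d"
proof (rule ccontr)
  assume no: "\<nexists>t. p dvd a*t^3 + b*t^2 + c*t + d"
  define P Q R where "P = b^2 - 3*a*c" and "Q = b*c - 9*a*d" and "R = c^2 - 3*b*d"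
  define f where "f t = a*t^3 + b*t^2 + c*t + d" for t
  define g where "g t = (3*a*t^2 + 2*b*t + c) * (Q*t + 2*R) - (b*t^2 + 2*c*t + 3*d) * (2*P*t + Q)"
    for t
  have coll: "2 * (f x * g y - g x * f y) =
      (x - y) * ((2*P*x*y + Q*(x + y) + 2*R)^2 - Disc (Cubic a b c d) * (x - y)^2)"
    and coll_infinity: "2 * (a * g x - (3*a*Q - 2*b*P) * f x) = (2*P*x + Q)^2 - Disc (Cubic a b c d)"
    for x y
    unfolding P_def Q_def R_def f_def g_def Disc.simps by algebra+
  have "\<exists>i. p dvd f t * i - 1" for t
    using no prime_inverse_int[OF p(1)] unfolding f_def by metis
  then obtain i where i: "\<And>t. p dvd f t * i t - 1" by metis
  have fi: "\<not> p dvd f t" for t using no by (auto simp: f_def)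
  \<comment> \<open>Up to the factor \<open>a\<close>, \<open>e t / f t\<close> is
    \<open>g / f\<close> minus its value at infinity. By \<open>coll_infinity\<close> it is never 0,
    so the \<open>p\<close> affine points share only \<open>p - 1\<close> possible values
    \<open>h t\<close>.\<close>
  define e where "e t = a * g t - (3*a*Q - 2*b*P) * f t" for t
  define h where "h t = (e t * i t) mod p" for t
  have e: "\<not> p dvd e t" for t
  proof
    assume "p dvd e t"
    then have "p dvd (2*P*t + Q)^2 - Disc (Cubic a b c d)"
      using coll_infinity[of t] unfolding e_def by (metis dvd_mult)
    then show False using nr by (simp add: nonresidue_def)
  qed
  have ii: "\<not> p dvd i t" for t
  proof
    assume "p dvd i t"
    then have "p dvd 1" using i[of t] by (metis dvd_mult dvd_diff_right_iff)
    then show False using p(1) not_prime_unit by blast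
  qed
  have "h ` {0..<p} \<subseteq> {1..<p}"
  proof
    fix y assume "y \<in> h ` {0..<p}"
    then obtain t where t: "y = h t" by blast
    have "\<not> p dvd e t * i t" using e ii p(1) by (simp add: prime_dvd_mult_iff)
    then have "h t \<noteq> 0" unfolding h_def by (simp add: dvd_eq_mod_eq_0)
    moreover have "0 \<le> h t" "h t < p" using p(2) by (simp_all add: h_def)
    ultimately show "y \<in> {1..<p}" using t by simp
  qed
  then have "card (h ` {0..<p}) \<le> card {1..<p}" by (intro card_mono) auto
  also have "\<dots> < card {0..<p}" using p(2) by simp
  finally have "\<not> inj_on h {0..<p}" by (metis card_image less_irrefl)
  then obtain s t where st: "s \<in> {0..<p}" "t \<in> {0..<p}" "s \<noteq> t" "h s = h t"
    unfolding inj_on_def by blast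
  have "p dvd e s * i s - e t * i t" using st(4) unfolding h_def by (metis mod_eq_dvd_iff)
  moreover have "a * (f s * g t - g s * f t) = e t * f s - e s * f t"
    unfolding e_def by algebra
  then have "a * (f s * g t - g s * f t) = - (e s * i s - e t * i t) * (f s * f t)
      + e s * f t * (f s * i s - 1) - e t * f s * (f t * i t - 1)"
    by algebra
  ultimately have "p dvd a * (f s * g t - g s * f t)"
    using i[of s] i[of t] by (metis dvd_add dvd_diff dvd_mult dvd_mult2 dvd_minus_iff)
  then have "p dvd f s * g t - g s * f t" using a p(1) by (simp add: prime_dvd_mult_iff)
  then have "p dvd (s - t) * ((2 * P * s * t + Q * (s + t) + 2*R)^2 - Disc (Cubic a b c d) * (s - t)^2)"
    using coll[of s t] by (metis dvd_mult)
  then have "p dvd s - t" using nonresidue_dvd[OF p(1) nr] p(1) prime_dvd_mult_iff by blast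
  then show False using st by (metis atLeastLessThan_iff mod_eq_dvd_iff mod_pos_pos_trivial)
qed

section \<open>Normal forms at a root or double root modulo \<open>p\<close>\<close>

lemma orbit_has_root:
  assumes p: "prime p" "p > 2" and nr: "nonresidue p (Disc f)"
  obtains \<gamma> a b c d where "\<gamma> \<in> SL2Z" "act \<gamma> f = Cubic (p * a) b c d"
proof (cases f)
  case (Cubic a b c d)
  show ?thesis
  proof (cases "p dvd a")
    case True
    then obtain a' where "a = p * a'" by blast
    then show ?thesis using that[OF one_in_SL2Z] Cubic act_one by metis
  next
    case False
    then obtain t where t: "p dvd a*t^3 + b*t^2 + c*t + d"
      using cubic_root_exists_if_nonresidue p nr Cubic by blast
    then obtain a' where a': "a*t^3 + b*t^2 + c*t + d = p * a'" by blast
    \<comment> \<open>The first row \<open>(t, 1)\<close> makes the value of the form at the root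
      its leading coefficient.\<close>
    then have "\<exists>b' c' d'. act (mat2 t 1 (-1) 0) f = Cubic (p * a') b' c' d'"
      unfolding Cubic act_mat2 by simp
    moreover have "mat2 t 1 (-1) 0 \<in> SL2Z" by simp
    ultimately show ?thesis using that by blast
  qed
qed

text \<open>Translating by \<open>t = - b / (3 * a)\<close> removes the quadratic term and turns the
  discriminant into \<open>- a * (4 * c1^3 + 27 * a * d1^2)\<close> modulo \<open>p\<close>. If
  \<open>p\<close> divides \<open>c1\<close>, it divides \<open>d1\<close> and \<open>t\<close> is a
  triple root; otherwise the double root is \<open>t - 3 * d1 / (2 * c1)\<close>.\<close>

lemma cubic_double_root_exists:
  assumes p: "prime p" "p > 3" and dvd: "p dvd Disc (Cubic a b c d)" and a: "\<not> p dvd a"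
  shows "\<exists>t. p dvd 3*a*t^2 + 2*b*t + c \<and> p dvd a*t^3 + b*t^2 + c*t + d"
proof -
  have p3: "\<not> p dvd 3" "\<not> p dvd 2" using p(2) zdvd_imp_le by fastforce+
  have "\<not> p dvd 3 * a" using a p p3 by (simp add: prime_dvd_mult_iff)
  then obtain i where i: "p dvd 3 * a * i - 1" using prime_inverse_int p(1) by blast
  define t where "t = - b * i"
  \<comment> \<open>These are the Taylor coefficients of the cubic at \<open>t\<close>.\<close>
  define b1 c1 d1 where "b1 = 3*a*t + b" and "c1 = 3*a*t^2 + 2*b*t + c" and "d1 = a*t^3 + b*t^2 + c*t + d"
  have "b1 = - b * (3 * a * i - 1)" unfolding b1_def t_def by algebra
  then have b1: "p dvd b1" using i by simp
  have "Disc (Cubic a b c d) = b1 * (b1*c1^2 - 4*b1^2*d1 + 18*a*c1*d1) - a * (4*c1^3 + 27*a*d1^2)"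
    unfolding b1_def c1_def d1_def Disc.simps by algebra
  then have "p dvd a * (4*c1^3 + 27*a*d1^2)"
    using dvd b1 by (metis dvd_diff_right_iff dvd_mult2)
  then have d: "p dvd 4*c1^3 + 27*a*d1^2" using a p(1) prime_dvd_mult_iff by blast
  show ?thesis
  proof (cases "p dvd c1")
    case True
    then have "p dvd 4*c1^3" by (simp add: power3_eq_cube)
    then have "p dvd 27*a*d1^2" using d by (simp add: dvd_add_right_iff)
    moreover have "27*a*d1^2 = 3 * (3 * 3) * a * d1^2" by simp
    ultimately have "p dvd 3 * (3 * 3) * a * d1^2" by (simp only:)
    then have "p dvd d1^2"
      using prime_dvd_multD[OF p(1)] a p3(1) by blast
    then have "p dvd d1" using p(1) prime_dvd_power by blast
    then show ?thesis using True unfolding c1_def d1_def by blast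
  next
    case False
    then have c2: "\<not> p dvd 2 * c1" using p3 p(1) by (simp add: prime_dvd_mult_iff)
    then obtain j where j: "p dvd 2 * c1 * j - 1" using prime_inverse_int p(1) by blast
    define u where "u = - 3 * d1 * j"
    have "2 * c1 * u + 3 * d1 = - 3 * d1 * (2 * c1 * j - 1)" unfolding u_def by algebra
    then have u: "p dvd 2 * c1 * u + 3 * d1" using j by simp
    have "(2*c1)^2 * (3*a*(t+u)^2 + 2*b*(t+u) + c) = (2*c1)^2 * (2 * u * b1)
        + 3*a * (2*c1*u - 3*d1) * (2 * c1 * u + 3 * d1) + (4*c1^3 + 27*a*d1^2)"
      unfolding b1_def c1_def d1_def by algebra
    then have "p dvd (2*c1)^2 * (3*a*(t+u)^2 + 2*b*(t+u) + c)"
      using b1 u d by (metis dvd_add dvd_mult)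
    then have 1: "p dvd 3*a*(t+u)^2 + 2*b*(t+u) + c"
      using c2 prime_dvd_multD[OF p(1)] prime_dvd_power[OF p(1)] by blast
    define w where "w = 2 * c1 * u"
    have "(2*c1)^3 * (a*(t+u)^3 + b*(t+u)^2 + c*(t+u) + d) =
        (2*c1)^3 * u^2 * b1 + (w + 3*d1) * (a * (w^2 - 3*d1*w + 9*d1^2) + 4*c1^3)
        - d1 * (4*c1^3 + 27*a*d1^2)"
      unfolding w_def b1_def c1_def d1_def by algebra
    then have "p dvd (2*c1)^3 * (a*(t+u)^3 + b*(t+u)^2 + c*(t+u) + d)"
      using b1 u d w_def by (metis dvd_add dvd_diff dvd_mult dvd_mult2)
    then have "p dvd a*(t+u)^3 + b*(t+u)^2 + c*(t+u) + d"
      using c2 prime_dvd_multD[OF p(1)] prime_dvd_power[OF p(1)] by blast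
    with 1 show ?thesis by blast
  qed
qed

text \<open>A finite double root is moved to \<open>(0, 1)\<close> by a shear, one at infinity by
  the swap. If infinity is a simple root, the quadratic cofactor has discriminant divisible by
  \<open>p\<close> and the double root is \<open>- c / (2 * b)\<close>.\<close>

lemma orbit_has_double_root:
  assumes p: "prime p" "p > 3" and dvd: "p dvd Disc f"
  obtains \<gamma> a b c d where "\<gamma> \<in> SL2Z" "act \<gamma> f = Cubic a b (p * c) (p * d)"
proof (cases f)
  case (Cubic a b c d)
  note result = that
  have shift: thesis if c': "p dvd 3*a*t^2 + 2*b*t + c" and d': "p dvd a*t^3 + b*t^2 + c*t + d" for t
  proof -
    obtain c' d' where "3*a*t^2 + 2*b*t + c = p * c'" "a*t^3 + b*t^2 + c*t + d = p * d'"
      using c' d' by (meson dvdE)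
    then have "\<exists>a' b'. act (mat2 1 0 t 1) f = Cubic a' b' (p * c') (p * d')"
      unfolding Cubic act_mat2 by simp
    moreover have "mat2 1 0 t 1 \<in> SL2Z" by simp
    ultimately show thesis using result by blast
  qed
  consider "\<not> p dvd a" | "p dvd a" "p dvd b" | "p dvd a" "\<not> p dvd b" by blast
  then show ?thesis
  proof cases
    case 1
    then show ?thesis using cubic_double_root_exists[OF p] dvd Cubic shift by blast
  next
    case 2
    then obtain a' b' where "a = p * a'" "b = p * b'" by (meson dvdE)
    then have "act (mat2 0 (-1) 1 0) f = Cubic (- d) c (p * - b') (p * a')"
      unfolding Cubic act_mat2 by simp
    moreover have "mat2 0 (-1) 1 0 \<in> SL2Z" by simp
    ultimately show ?thesis using that by blast
  next
    case 3
    then obtain a' where a': "a = p * a'" by blast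
    have p2: "\<not> p dvd 2" using p(2) zdvd_imp_le by fastforce
    then have b2: "\<not> p dvd 2 * b" using 3 p(1) by (simp add: prime_dvd_mult_iff)
    have "b^2 * (c^2 - 4*b*d) = Disc f + p * a' * (4*c^3 + 27*a*d^2 - 18*b*c*d)"
      unfolding Cubic Disc.simps a' by algebra
    then have "p dvd b^2 * (c^2 - 4*b*d)" using dvd by simp
    then have disc: "p dvd c^2 - 4*b*d"
      using 3 p(1) by (simp add: prime_dvd_mult_iff prime_dvd_power_iff)
    obtain j where j: "p dvd 2 * b * j - 1" using prime_inverse_int p(1) b2 by blast
    define t where "t = - c * j"
    have "2*b*t + c = - c * (2 * b * j - 1)" unfolding t_def by algebra
    then have t: "p dvd 2*b*t + c" using j by simp
    have "3*a*t^2 + 2*b*t + c = p * (3*a'*t^2) + (2*b*t + c)" unfolding a' by algebra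
    then have 1: "p dvd 3*a*t^2 + 2*b*t + c" using t by (metis dvd_add dvd_triv_left)
    have "2*(2*b) * (a*t^3 + b*t^2 + c*t + d)
        = p * (4*b*a'*t^3) + (2*b*t + c) * (2*b*t + c) - (c^2 - 4*b*d)"
      unfolding a' by algebra
    then have "p dvd 2*(2*b) * (a*t^3 + b*t^2 + c*t + d)" using t disc by simp
    then have "p dvd a*t^3 + b*t^2 + c*t + d"
      using b2 p2 p(1) by (metis prime_dvd_mult_iff)
    with 1 show ?thesis using shift by blast
  qed
qed

text \<open>If the double root mod \<open>p\<close> did not lift to a nonmaximal form, it would be a triple root, and
  \<open>D\<close> would be congruent to \<open>-27 (a d)\<^sup>2\<close>, a square because \<open>-3\<close> is one.\<close>

lemma orbit_nonmaximal:
  assumes p: "prime p" "p > 3" and r: "p dvd r^2 + 3" and nr: "nonresidue p D"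
    and D: "Disc f = D * p^2"
  obtains \<gamma> a b c d where "\<gamma> \<in> SL2Z" "act \<gamma> f = Cubic a b (p * c) (p^2 * d)"
proof -
  have "p dvd Disc f" using D by simp
  then obtain \<gamma> a b c d where \<gamma>: "\<gamma> \<in> SL2Z" "act \<gamma> f = Cubic a b (p * c) (p * d)"
    using orbit_has_double_root[OF p] by blast
  have p0: "p \<noteq> 0" using p by auto
  have disc: "Disc (Cubic a b (p * c) (p * d)) = D * p^2"
    using Disc_act[OF \<gamma>(1), of f] \<gamma>(2) D by simp
  have "p dvd d"
  proof (rule ccontr)
    assume d: "\<not> p dvd d"
    \<comment> \<open>Every term of the discriminant except \<open>- 4 * b^3 * (p * d)\<close> is
      divisible by \<open>p^2\<close>, which forces \<open>b\<close> to vanish modulo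
      \<open>p\<close>: the root is triple.\<close>
    have "p * (4*b^3*d) = p * (p * (b^2*c^2 - 4*a*p*c^3 - 27*a^2*d^2 + 18*a*b*c*d - D))"
      using disc unfolding Disc.simps by algebra
    then have "p dvd 4*b^3*d" using p0 by simp
    moreover have "\<not> p dvd 2" using p(2) zdvd_imp_le by fastforce
    then have "\<not> p dvd 2 * 2" using p(1) prime_dvd_mult_iff by blast
    then have "\<not> p dvd 4" by simp
    ultimately have "p dvd b" using d p(1) by (simp add: prime_dvd_mult_iff prime_dvd_power_iff)
    then obtain b' where b': "b = p * b'" by blast
    have "p^2 * ((r * (3*a*d))^2 - D)
        = p^2 * ((r^2 + 3) * (3*a*d)^2 + p * (4*a*c^3 - p*b'^2*c^2 - 18*a*b'*c*d + 4*b'^3*d*p))"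
      using disc unfolding Disc.simps b' by algebra
    then have "(r * (3*a*d))^2 - D
        = (r^2 + 3) * (3*a*d)^2 + p * (4*a*c^3 - p*b'^2*c^2 - 18*a*b'*c*d + 4*b'^3*d*p)"
      using p0 by simp
    then have "p dvd (r * (3*a*d))^2 - D" using r by simp
    then show False using nr by (simp add: nonresidue_def)
  qed
  then show ?thesis using that \<gamma> by (metis dvdE mult.assoc power2_eq_square)
qed

section \<open>Class numbers of discriminants \<open>D\<close> and \<open>D * p^2\<close>\<close>

lemma orbit_in_orbits_of_disc [simp]: "orbit f \<in> orbits_of_disc D \<longleftrightarrow> Disc f = D"
proof
  assume "orbit f \<in> orbits_of_disc D"
  then obtain g where "orbit f = orbit g" "Disc g = D" by (auto simp: orbits_of_disc_def)
  then show "Disc f = D" by (metis orbit_rep_invariants(1))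
qed (auto simp: orbits_of_disc_def)

text \<open>The weighted class number, written \<open>h\<close> in the outline.\<close>

definition class_sum :: "int \<Rightarrow> real" where
  "class_sum D = infsum orbit_weight (orbits_of_disc D)"

text \<open>Each orbit has a representative with its root modulo \<open>p\<close> at
  \<open>(1, 0)\<close>, and \<open>\<Phi>\<close> passes to the corresponding subform. The
  bijections of transporters make \<open>\<Phi>\<close> injective and weight preserving;
  \<open>orbit_nonmaximal\<close> makes it surjective.\<close>

lemma class_sum_inert:
  assumes p: "prime p" "p > 3" and r: "p dvd r^2 + 3" and nr: "nonresidue p D"
  shows "class_sum (D * p^2) = class_sum D"
proof -
  have p0: "p \<noteq> 0" using p by auto
  have disc: "Disc (Cubic a b (p * c) (p^2 * d)) = Disc (Cubic (p * a) b c d) * p^2" for a b c d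
    unfolding Disc.simps by algebra
  have "\<exists>a b c d. X = orbit (Cubic (p * a) b c d)" if X: "X \<in> orbits_of_disc D" for X
  proof -
    obtain f where f: "X = orbit f" "Disc f = D" using X by (auto simp: orbits_of_disc_def)
    have "p > 2" "nonresidue p (Disc f)" using p nr f by auto
    then obtain \<gamma> a b c d where "\<gamma> \<in> SL2Z" "act \<gamma> f = Cubic (p * a) b c d"
      using orbit_has_root[OF p(1)] by blast
    then show ?thesis using f orbit_act by metis
  qed
  then obtain a b c d where abcd:
    "\<And>X. X \<in> orbits_of_disc D \<Longrightarrow> X = orbit (Cubic (p * a X) (b X) (c X) (d X))"
    by metis
  have D: "Disc (Cubic (p * a X) (b X) (c X) (d X)) = D" if X: "X \<in> orbits_of_disc D" for X
    using X abcd[OF X] orbit_in_orbits_of_disc by metis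
  define \<Phi> where "\<Phi> X = orbit (Cubic (a X) (b X) (p * c X) (p^2 * d X))" for X
  have bij: "\<exists>h. bij_betw h (transporter (Cubic (p * a X) (b X) (c X) (d X)) (Cubic (p * a') b' c' d'))
      (transporter (Cubic (a X) (b X) (p * c X) (p^2 * d X)) (Cubic a' b' (p * c') (p^2 * d')))"
    if "X \<in> orbits_of_disc D" for X a' b' c' d'
    using bij_transporter[OF p(1)] D[OF that] nr by blast
  have empty_iff: "A = {} \<longleftrightarrow> B = {}" if "\<exists>h. bij_betw h A B" for A B :: "(int ^ 2 ^ 2) set"
    using that by (auto simp: bij_betw_def)
  have "bij_betw \<Phi> (orbits_of_disc D) (orbits_of_disc (D * p^2))"
  proof (rule bij_betwI')
    fix X Y assume X: "X \<in> orbits_of_disc D" and Y: "Y \<in> orbits_of_disc D"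
    show "\<Phi> X = \<Phi> Y \<longleftrightarrow> X = Y"
      using empty_iff[OF bij[OF X]] abcd[OF X] abcd[OF Y] unfolding \<Phi>_def by (metis orbit_eq_iff)
  next
    fix X assume "X \<in> orbits_of_disc D"
    then show "\<Phi> X \<in> orbits_of_disc (D * p^2)"
      using D by (simp add: \<Phi>_def disc del: Disc.simps)
  next
    fix Y assume "Y \<in> orbits_of_disc (D * p^2)"
    then obtain f where f: "Y = orbit f" "Disc f = D * p^2" by (auto simp: orbits_of_disc_def)
    then obtain \<gamma> a' b' c' d' where \<gamma>: "\<gamma> \<in> SL2Z" "act \<gamma> f = Cubic a' b' (p * c') (p^2 * d')"
      using orbit_nonmaximal[OF p r nr] by metis
    define X where "X = orbit (Cubic (p * a') b' c' d')"
    have "Disc (Cubic (p * a') b' c' d') * p^2 = D * p^2"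
      using Disc_act[OF \<gamma>(1), of f] unfolding \<gamma>(2) f(2) disc .
    then have X: "X \<in> orbits_of_disc D" using p0 by (simp add: X_def del: Disc.simps)
    have "\<Phi> X = orbit (Cubic a' b' (p * c') (p^2 * d'))"
      using empty_iff[OF bij[OF X]] abcd[OF X] X_def unfolding \<Phi>_def by (metis orbit_eq_iff)
    also have "\<dots> = Y" using \<gamma> f orbit_act by metis
    finally show "\<exists>X \<in> orbits_of_disc D. Y = \<Phi> X" using X by blast
  qed
  moreover have "orbit_weight (\<Phi> X) = orbit_weight X" if X: "X \<in> orbits_of_disc D" for X
  proof -
    have "card (Stab (Cubic (p * a X) (b X) (c X) (d X))) =
        card (Stab (Cubic (a X) (b X) (p * c X) (p^2 * d X)))"
      unfolding Stab_eq_transporter using bij[OF X] bij_betw_same_card by blast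
    then show ?thesis using abcd[OF X] unfolding \<Phi>_def by (metis orbit_weight_orbit)
  qed
  ultimately show ?thesis
    unfolding class_sum_def by (metis (no_types, lifting) infsum_cong infsum_reindex_bij_betw)
qed

subsection \<open>Finiteness\<close>

text \<open>The classical syzygy between a cubic form, its Hessian \<open>H\<close> and its cubic
  covariant \<open>G\<close>, with the square of \<open>G\<close> dropped.\<close>

lemma hessian_syzygy_le:
  fixes a b c d x y :: int
  defines "H \<equiv> (b^2 - 3*a*c) * x^2 + (b*c - 9*a*d) * x * y + (c^2 - 3*b*d) * y^2"
  shows "27 * Disc (Cubic a b c d) * (a*x^3 + b*x^2*y + c*x*y^2 + d*y^3)^2 \<le> 4 * H^3"
proof -
  define P Q R where "P = b^2 - 3*a*c" and "Q = b*c - 9*a*d" and "R = c^2 - 3*b*d"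
  define G where "G = (3*a*x^2 + 2*b*x*y + c*y^2) * (Q*x + 2*R*y)
      - (b*x^2 + 2*c*x*y + 3*d*y^2) * (2*P*x + Q*y)"
  have "4 * H^3 = G^2 + 27 * Disc (Cubic a b c d) * (a*x^3 + b*x^2*y + c*x*y^2 + d*y^3)^2"
    unfolding H_def G_def P_def Q_def R_def Disc.simps by algebra
  then show ?thesis by simp
qed

lemma abs_le_square_int: "\<bar>x\<bar> \<le> x^2" for x :: int
proof (cases "x = 0")
  case False
  then have "\<bar>x\<bar> * 1 \<le> \<bar>x\<bar> * \<bar>x\<bar>" by (intro mult_left_mono) auto
  then show ?thesis by (simp add: power2_eq_square flip: abs_mult)
qed simp

text \<open>For positive discriminant the syzygy turns an upper bound on the Hessian into a bound on
  the form itself.\<close>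

lemma form_value_bound:
  fixes a b c d x y B :: int
  assumes "Disc (Cubic a b c d) > 0"
    and "(b^2 - 3*a*c) * x^2 + (b*c - 9*a*d) * x * y + (c^2 - 3*b*d) * y^2 \<le> B" (is "?H \<le> _")
    and "B \<ge> 0"
  shows "\<bar>a*x^3 + b*x^2*y + c*x*y^2 + d*y^3\<bar> \<le> 4 * B^3" (is "\<bar>?f\<bar> \<le> _")
proof -
  have "\<bar>?f\<bar> \<le> ?f^2" by (rule abs_le_square_int)
  also have "\<dots> \<le> 27 * Disc (Cubic a b c d) * ?f^2"
    using assms(1) by (intro mult_le_cancel_right1[THEN iffD2]) auto
  also have "\<dots> \<le> 4 * ?H^3" by (rule hessian_syzygy_le)
  also have "\<dots> \<le> 4 * B^3"
    using power_mono_odd[of 3 ?H B] assms(2) by simp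
  finally show ?thesis .
qed

text \<open>A shear by \<open>t\<close> adds \<open>2 * t * m\<close> to the middle coefficient of a
  quadratic form with leading coefficient \<open>m\<close>; this is the choice of \<open>t\<close>
  for reduction.\<close>

lemma ex_centered_remainder:
  fixes m n :: int
  assumes "m \<noteq> 0"
  shows "\<exists>t. \<bar>n + 2 * t * m\<bar> \<le> \<bar>m\<bar>"
proof -
  define q where "q = (n + \<bar>m\<bar>) div (2 * \<bar>m\<bar>)"
  have "n + \<bar>m\<bar> = 2 * \<bar>m\<bar> * q + (n + \<bar>m\<bar>) mod (2 * \<bar>m\<bar>)" unfolding q_def by simp
  moreover have "0 \<le> (n + \<bar>m\<bar>) mod (2 * \<bar>m\<bar>)" "(n + \<bar>m\<bar>) mod (2 * \<bar>m\<bar>) < 2 * \<bar>m\<bar>"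
    using assms by simp_all
  ultimately have "\<bar>n - 2 * \<bar>m\<bar> * q\<bar> \<le> \<bar>m\<bar>" by linarith
  moreover have "n - 2 * \<bar>m\<bar> * q = n + 2 * (- sgn m * q) * m"
    by (simp add: abs_sgn mult_ac)
  ultimately show ?thesis by metis
qed

text \<open>Gauss reduction of the Hessian, a quadratic covariant. Take a form in the orbit whose
  leading Hessian coefficient is smallest in absolute value, shear to shrink the middle one, and
  compare with the swapped form, which exchanges the outer two.\<close>

lemma reduced_form_exists:
  assumes "X \<in> orbits_of_disc D" "D > 0"
  obtains a b c d where "X = orbit (Cubic a b c d)" "Disc (Cubic a b c d) = D"
    "\<bar>b*c - 9*a*d\<bar> \<le> \<bar>b^2 - 3*a*c\<bar>" "\<bar>b^2 - 3*a*c\<bar> \<le> \<bar>c^2 - 3*b*d\<bar>"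
proof -
  define m where "m f = (case f of Cubic a b c d \<Rightarrow> nat \<bar>b^2 - 3*a*c\<bar>)" for f
  obtain f0 where f0: "X = orbit f0" "Disc f0 = D" using assms by (auto simp: orbits_of_disc_def)
  then obtain f where f: "orbit f = X" and least: "\<And>g. orbit g = X \<Longrightarrow> m f \<le> m g"
    using ex_has_least_nat[of "\<lambda>f. orbit f = X" f0 m] by metis
  obtain a b c d where abcd: "f = Cubic a b c d" by (cases f)
  have D: "Disc f = D" using f f0 by (metis orbit_rep_invariants(1))
  have "b^2 - 3*a*c \<noteq> 0"
  proof
    assume "b^2 - 3*a*c = 0"
    \<comment> \<open>The Hessian has discriminant \<open>- 3 * Disc f\<close>, so it cannot have
      leading coefficient 0.\<close>
    moreover have "(b*c - 9*a*d)^2 + 3 * Disc f = 4 * (b^2 - 3*a*c) * (c^2 - 3*b*d)"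
      unfolding abcd Disc.simps by algebra
    ultimately show False using D assms(2) by (simp add: add_nonneg_eq_0_iff)
  qed
  then obtain t where t: "\<bar>(b*c - 9*a*d) + 2 * t * (b^2 - 3*a*c)\<bar> \<le> \<bar>b^2 - 3*a*c\<bar>"
    using ex_centered_remainder by blast
  define b' c' d' where "b' = 3*a*t + b" and "c' = 3*a*t^2 + 2*b*t + c" and "d' = a*t^3 + b*t^2 + c*t + d"
  have g: "act (mat2 1 0 t 1) f = Cubic a b' c' d'"
    unfolding abcd act_mat2 b'_def c'_def d'_def by simp
  moreover have sl: "mat2 1 0 t 1 \<in> SL2Z" by simp
  ultimately have X: "orbit (Cubic a b' c' d') = X" using f orbit_act by metis
  have "act (mat2 0 (-1) 1 0) (Cubic a b' c' d') = Cubic (- d') c' (- b') a" by simp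
  moreover have "mat2 0 (-1) 1 0 \<in> SL2Z" by simp
  ultimately have "orbit (Cubic (- d') c' (- b') a) = X" using X orbit_act by metis
  then have "\<bar>b^2 - 3*a*c\<bar> \<le> \<bar>c'^2 - 3*b'*d'\<bar>"
    using least[of "Cubic (- d') c' (- b') a"] by (simp add: m_def abcd mult_ac)
  moreover have "b'^2 - 3*a*c' = b^2 - 3*a*c" unfolding b'_def c'_def by algebra
  moreover have "b'*c' - 9*a*d' = (b*c - 9*a*d) + 2 * t * (b^2 - 3*a*c)"
    unfolding b'_def c'_def d'_def by algebra
  moreover have "Disc (Cubic a b' c' d') = D" using Disc_act[OF sl] g D by metis
  ultimately show ?thesis using that[of a b' c' d'] X t by simp
qed

text \<open>For a reduced form, \<open>4 * P * R = Q^2 + 3 * D\<close> bounds the Hessian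
  coefficients by \<open>D\<close>. This bounds the values of the form at four points, and these
  determine its coefficients.\<close>

lemma finite_orbits_of_disc:
  assumes D: "D > 0"
  shows "finite (orbits_of_disc D)"
proof -
  \<comment> \<open>At the test points the Hessian is a sum of three terms, each at most
    \<open>D\<close> and hence at most \<open>D^2 + 3 * D\<close>; \<open>form_value_bound\<close>
    does the rest.\<close>
  define B where "B = 4 * (3 * (D^2 + 3 * D))^3"
  let ?I = "{- 2 * B..2 * B}"
  have "orbits_of_disc D \<subseteq> (\<lambda>(a, b, c, d). orbit (Cubic a b c d)) ` (?I \<times> ?I \<times> ?I \<times> ?I)"
  proof
    fix X assume "X \<in> orbits_of_disc D"
    then obtain a b c d where X: "X = orbit (Cubic a b c d)" "Disc (Cubic a b c d) = D"
      and red: "\<bar>b*c - 9*a*d\<bar> \<le> \<bar>b^2 - 3*a*c\<bar>" "\<bar>b^2 - 3*a*c\<bar> \<le> \<bar>c^2 - 3*b*d\<bar>"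
      using reduced_form_exists D by blast
    define P Q R where "P = b^2 - 3*a*c" and "Q = b*c - 9*a*d" and "R = c^2 - 3*b*d"
    note PQR = P_def[symmetric] Q_def[symmetric] R_def[symmetric]
    have "Q^2 + 3 * Disc (Cubic a b c d) = 4 * (P * R)"
      unfolding P_def Q_def R_def Disc.simps by algebra
    then have PR: "Q^2 + 3 * D = 4 * (P * R)" using X by simp
    have QP: "Q^2 \<le> P^2" using red unfolding PQR by (simp add: abs_le_square_iff)
    have "P * R > 0" using PR D by (smt (verit) zero_le_power2)
    then have abs: "P * R = \<bar>P\<bar> * \<bar>R\<bar>" by (metis abs_mult abs_of_pos)
    have "P \<noteq> 0" "R \<noteq> 0" using \<open>P * R > 0\<close> by auto
    then have nz: "\<bar>P\<bar> \<ge> 1" "\<bar>R\<bar> \<ge> 1" by simp_all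
    have "P^2 \<le> P * R" using red unfolding PQR abs
      by (metis abs_ge_zero mult_left_mono power2_abs power2_eq_square)
    then have PD: "P^2 \<le> D" using PR QP by linarith
    then have P: "\<bar>P\<bar> \<le> D" using abs_le_square_int[of P] by linarith
    have Q: "\<bar>Q\<bar> \<le> D" using red P unfolding PQR by linarith
    have "1 * \<bar>R\<bar> \<le> P * R" unfolding abs using nz by (intro mult_right_mono) auto
    then have R: "\<bar>R\<bar> \<le> D" using PR QP PD by linarith
    have DD: "D \<le> D^2 + 3 * D" using D by simp
    have bound: "\<bar>a*x^3 + b*x^2*y + c*x*y^2 + d*y^3\<bar> \<le> B"
      if "x^2 \<le> 1" "y^2 \<le> 1" "\<bar>x * y\<bar> \<le> 1" for x y
    proof -
      have 1: "u * z \<le> D" if "\<bar>u\<bar> \<le> D" "\<bar>z\<bar> \<le> 1" for u z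
      proof -
        have "u * z \<le> \<bar>u\<bar> * \<bar>z\<bar>" by (metis abs_ge_self abs_mult)
        also have "\<dots> \<le> D * 1" using that D by (intro mult_mono) auto
        finally show ?thesis by simp
      qed
      have "P * x^2 + Q * (x * y) + R * y^2 \<le> 3 * (D^2 + 3 * D)"
        using 1[OF P, of "x^2"] 1[OF Q, of "x * y"] 1[OF R, of "y^2"] that DD by simp
      then have "P * x^2 + Q * x * y + R * y^2 \<le> 3 * (D^2 + 3 * D)" by (simp only: mult.assoc)
      then show ?thesis
        unfolding B_def P_def Q_def R_def using X D by (intro form_value_bound) simp_all
    qed
    from bound[of 1 0] bound[of 0 1] bound[of 1 1] bound[of 1 "-1"]
    have "\<bar>a\<bar> \<le> B" "\<bar>d\<bar> \<le> B" "\<bar>a + b + c + d\<bar> \<le> B" "\<bar>a - b + c - d\<bar> \<le> B" by simp_all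
    then have "a \<in> ?I" "b \<in> ?I" "c \<in> ?I" "d \<in> ?I" by auto
    then show "X \<in> (\<lambda>(a, b, c, d). orbit (Cubic a b c d)) ` (?I \<times> ?I \<times> ?I \<times> ?I)"
      using X(1) by force
  qed
  then show ?thesis by (rule finite_subset) (intro finite_imageI finite_cartesian_product finite_atLeastAtMost_int)
qed

subsection \<open>Reducible forms\<close>

text \<open>As the discriminant is not a square, the quadratic cofactor is irreducible over the
  rationals. So \<open>(1, 0)\<close> is the only rational root and is fixed up to sign; positivity
  of \<open>b\<close> and \<open>b'\<close> fixes the sign.\<close>

lemma transporter_reducible:
  assumes "\<And>m. Disc (Cubic 0 b c d) \<noteq> m^2" "b > 0" "b' > 0"
    and "\<gamma> \<in> transporter (Cubic 0 b c d) (Cubic 0 b' c' d')"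
  obtains z where "\<gamma> = mat2 1 0 z 1" "b' = b" "c' = 2 * b * z + c"
proof (cases \<gamma> rule: mat2_cases)
  case (1 x y z w)
  have det: "x * w - y * z = 1"
    and lead: "y * (b * x^2 + c * x * y + d * y^2) = 0"
    and b': "b * (x^2 * w + 2 * x * y * z) + c * (2 * x * y * w + y^2 * z) + 3 * d * y^2 * w = b'"
    and c': "b * (2 * x * z * w + y * z^2) + c * (x * w^2 + 2 * y * z * w) + 3 * d * y * w^2 = c'"
    using assms(4) unfolding 1 transporter_def by (auto simp: power2_eq_square power3_eq_cube algebra_simps)
  have y: "y = 0"
  proof (rule ccontr)
    assume y: "y \<noteq> 0"
    then have "b * x^2 + c * x * y + d * y^2 = 0" using lead by simp
    moreover have "Disc (Cubic 0 b c d) * y^2 + 4 * b^3 * (b * x^2 + c * x * y + d * y^2)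
        = (b * (2 * b * x + c * y))^2"
      by simp algebra
    ultimately have sq: "Disc (Cubic 0 b c d) * y^2 = (b * (2 * b * x + c * y))^2" by simp
    then have "y^2 dvd (b * (2 * b * x + c * y))^2" by (metis dvd_triv_right)
    then have "y dvd b * (2 * b * x + c * y)" by (simp only: pow_divides_pow_iff zero_less_numeral)
    then obtain m where "b * (2 * b * x + c * y) = y * m" by blast
    then have "Disc (Cubic 0 b c d) = m^2" using sq y by (simp add: power_mult_distrib)
    then show False using assms(1) by blast
  qed
  then have xw: "x * w = 1" using det by simp
  have "b * x * (x * w) = b'" using b' y by (simp add: power2_eq_square mult_ac)
  then have "b * x = b'" by (simp only: xw mult_1_right)
  then have "x > 0" using assms(2,3) by (metis zero_less_mult_pos)
  then have "x = 1" "w = 1" using xw pos_zmult_eq_1_iff by auto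
  then show ?thesis using that[of z] 1 y b' c' by simp
qed

text \<open>By \<open>transporter_reducible\<close> the coefficient \<open>b\<close> is an invariant
  of the orbit and the stabilizer is trivial, so each element of \<open>S\<close> contributes weight
  1.\<close>

lemma class_sum_ge_card:
  assumes D: "D > 0" "\<And>m. D \<noteq> m^2"
    and S: "\<And>b. b \<in> S \<Longrightarrow> b > 0 \<and> (\<exists>c d. Disc (Cubic 0 b c d) = D)"
  shows "real (card S) \<le> class_sum D"
proof -
  obtain c d where cd: "\<And>b. b \<in> S \<Longrightarrow> Disc (Cubic 0 b (c b) (d b)) = D"
    using S by metis
  define F where "F b = orbit (Cubic 0 b (c b) (d b))" for b
  have inj: "inj_on F S"
  proof (rule inj_onI)
    fix b b' assume *: "b \<in> S" "b' \<in> S" "F b = F b'"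
    then obtain \<gamma> where "\<gamma> \<in> transporter (Cubic 0 b (c b) (d b)) (Cubic 0 b' (c b') (d b'))"
      unfolding F_def orbit_eq_iff by blast
    then show "b = b'"
      using transporter_reducible[of b "c b" "d b" b'] cd[OF *(1)] D(2) S * by metis
  qed
  have "Stab (Cubic 0 b (c b) (d b)) = {mat 1}" if b: "b \<in> S" for b
  proof (intro equalityI subsetI)
    fix \<gamma> assume "\<gamma> \<in> Stab (Cubic 0 b (c b) (d b))"
    then obtain z where "\<gamma> = mat2 1 0 z 1" "c b = 2 * b * z + c b"
      unfolding Stab_eq_transporter using transporter_reducible[of b "c b" "d b" b] cd[OF b] D(2) S[OF b]
      by metis
    then show "\<gamma> \<in> {mat 1}" using S[OF b] by (simp add: mat_1_eq_mat2)
  qed (simp add: Stab_def one_in_SL2Z act_one)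
  then have weight: "orbit_weight (F b) = 1" if "b \<in> S" for b
    using that by (simp add: F_def orbit_weight_orbit)
  have sub: "F ` S \<subseteq> orbits_of_disc D"
    using cd by (auto simp: F_def simp del: Disc.simps)
  have "real (card S) = sum orbit_weight (F ` S)"
    using inj weight by (simp add: sum.reindex)
  also have "\<dots> \<le> sum orbit_weight (orbits_of_disc D)"
    using finite_orbits_of_disc[OF D(1)] sub by (intro sum_mono2) (auto simp: orbit_weight_def)
  also have "\<dots> = class_sum D"
    using finite_orbits_of_disc[OF D(1)] by (simp add: class_sum_def)
  finally show ?thesis .
qed

subsection \<open>Choice of primes and discriminants\<close>

definition split_prime :: "int \<Rightarrow> int \<Rightarrow> bool" where
  "split_prime D p \<longleftrightarrow> prime p \<and> p > 3 \<and> (\<exists>r. p dvd r^2 + 3) \<and> (\<exists>t. p dvd t^2 - D)"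

lemma prime_gt_3_if_not_dvd_6: "prime p \<Longrightarrow> \<not> p dvd 6 \<Longrightarrow> p > 3" for p :: int
proof (rule ccontr)
  assume *: "prime p" "\<not> p dvd 6" "\<not> p > 3"
  then have "p = 2 \<or> p = 3" using prime_ge_2_int[of p] by auto
  then show False using *(2) by auto
qed

text \<open>A prime divisor of \<open>x\<^sup>4 + (6 - 2 D) x\<^sup>2 + (3 + D)\<^sup>2\<close>, the value at \<open>x\<close> of the minimal polynomial
  of \<open>\<surd>(-3) + \<surd>D\<close>, makes both \<open>-3\<close> and \<open>D\<close> squares. The multiple \<open>x\<close> of \<open>3 + D\<close> is chosen
  so that the cofactor of \<open>(3 + D)\<^sup>2\<close> is 1 modulo any prescribed number.\<close>

lemma split_prime_exists:
  fixes D M :: int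
  assumes "D > 0" "M \<noteq> 0"
  shows "\<exists>p. split_prime D p \<and> \<not> p dvd M"
proof -
  \<comment> \<open>\<open>K\<close> is 1 modulo \<open>N\<close>, so a prime factor of
    \<open>K\<close> divides none of 6, \<open>M\<close> and \<open>3 + D\<close>. The polynomial
    takes the value \<open>(3 + D)^2 * K\<close> at \<open>x\<close>.\<close>
  define N where "N = 6 * M * (3 + D)"
  define K where "K = (3 + D)^2 * N^4 + (6 - 2 * D) * N^2 + 1"
  define x where "x = (3 + D) * N"
  have "N \<noteq> 0" using assms by (simp add: N_def)
  have "K = N^2 * ((3 + D)^2 * (N^2 - 1) + (D^2 + 4 * D + 15)) + 1"
    unfolding K_def by algebra
  moreover have "N^2 \<ge> 1" using \<open>N \<noteq> 0\<close> by (simp add: int_one_le_iff_zero_less)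
  then have "(3 + D)^2 * (N^2 - 1) + (D^2 + 4 * D + 15) > 0"
    using assms by (intro add_nonneg_pos mult_nonneg_nonneg) auto
  then have "N^2 * ((3 + D)^2 * (N^2 - 1) + (D^2 + 4 * D + 15)) > 0"
    using \<open>N \<noteq> 0\<close> by simp
  ultimately have "K > 1" by linarith
  then obtain p where p: "prime p" "p dvd K" using prime_factor_int[of K] by auto
  have pN: "\<not> p dvd N"
  proof
    assume "p dvd N"
    then have "p dvd (3 + D)^2 * N^4 + (6 - 2 * D) * N^2" by (simp add: power2_eq_square power4_eq_xxxx)
    then have "p dvd 1" using p(2) unfolding K_def by (simp add: dvd_add_right_iff)
    then show False using p(1) not_prime_unit by blast
  qed
  then have p6: "\<not> p dvd 6" "\<not> p dvd M" "\<not> p dvd 3 + D" unfolding N_def by auto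
  then have "\<not> p dvd 2" using dvd_trans[of p 2 6] by auto
  then have "\<not> p dvd 2 * x" using pN p6 p(1) unfolding x_def by (simp add: prime_dvd_mult_iff)
  then obtain i where i: "p dvd 2 * x * i - 1" using prime_inverse_int p(1) by blast
  \<comment> \<open>If \<open>x\<close> is the sum of roots of \<open>-3\<close> and
    \<open>D\<close>, these are \<open>(x - (3 + D) / x) / 2\<close> and
    \<open>(x + (3 + D) / x) / 2\<close>; \<open>i\<close> stands for
    \<open>1 / (2 * x)\<close>.\<close>
  have "((x^2 - (3 + D)) * i)^2 + 3 = (3 + D)^2 * K * i^2 - 3 * (2 * x * i + 1) * (2 * x * i - 1)"
    unfolding K_def x_def by algebra
  then have 1: "p dvd ((x^2 - (3 + D)) * i)^2 + 3" using p(2) i by simp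
  have "((x^2 + (3 + D)) * i)^2 - D = (3 + D)^2 * K * i^2 + D * (2 * x * i + 1) * (2 * x * i - 1)"
    unfolding K_def x_def by algebra
  then have 2: "p dvd ((x^2 + (3 + D)) * i)^2 - D" using p(2) i by simp
  show ?thesis using 1 2 p(1) p6 prime_gt_3_if_not_dvd_6 unfolding split_prime_def by blast
qed

lemma split_primes_exist:
  fixes D M :: int
  assumes "D > 0" "M \<noteq> 0"
  shows "\<exists>S. finite S \<and> card S = n \<and> (\<forall>p\<in>S. split_prime D p \<and> \<not> p dvd M)"
proof (induction n)
  case 0
  show ?case by (rule exI[of _ "{}"]) simp
next
  case (Suc n)
  then obtain S where S: "finite S" "card S = n" "\<forall>p\<in>S. split_prime D p \<and> \<not> p dvd M" by blast
  have "M * \<Prod>S \<noteq> 0" using assms(2) S by (auto simp: split_prime_def)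
  then obtain p where p: "split_prime D p" "\<not> p dvd M * \<Prod>S"
    using split_prime_exists[OF assms(1)] by blast
  then have "p \<notin> S" using S(1) using dvd_prodI[of S p "\<lambda>x. x"] by auto
  moreover have "\<not> p dvd M" using p(2) by auto
  ultimately show ?case using S p by (intro exI[of _ "insert p S"]) auto
qed

lemma square_mod_8_ne_5: "x^2 mod 8 \<noteq> 5" for x :: int
proof -
  have "x mod 8 \<in> {0, 1, 2, 3, 4, 5, 6, 7}" by (simp; presburger)
  moreover have "x^2 mod 8 = (x mod 8)^2 mod 8" by (simp add: power_mod)
  ultimately show ?thesis by auto
qed

lemma odd_square_mod_8: "odd x \<Longrightarrow> x^2 mod 8 = 1" for x :: int
proof -
  assume "odd x"
  then have "x mod 8 \<in> {1, 3, 5, 7}" by (simp; presburger)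
  moreover have "x^2 mod 8 = (x mod 8)^2 mod 8" by (simp add: power_mod)
  ultimately show ?thesis by auto
qed

lemma mult_odd_square_mod_8:
  fixes D x :: int
  assumes "D mod 8 = 5" "odd x"
  shows "D * x^2 mod 8 = 5"
  using mod_mult_eq[of D 8 "x^2"] odd_square_mod_8[OF assms(2)] assms(1) by simp

lemma odd_split_prime: "split_prime D p \<Longrightarrow> odd p"
  unfolding split_prime_def using prime_odd_int by force

text \<open>Each \<open>p\<close> in \<open>S\<close> is the coefficient \<open>b\<close> of a
  reducible form: with \<open>\<Prod>S = p * m\<close>, it suffices to solve
  \<open>c^2 = D * m^2\<close> modulo \<open>4 * p\<close>. Being 5 modulo 8, the discriminant is
  not a square.\<close>

lemma class_sum_split_primes:
  assumes D: "D > 0" "D mod 8 = 5" and S: "finite S" "\<And>p. p \<in> S \<Longrightarrow> split_prime D p"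
  shows "real (card S) \<le> class_sum (D * (\<Prod>S)^2)"
proof (rule class_sum_ge_card)
  have S0: "p > 0" if "p \<in> S" for p using S(2)[OF that] by (simp add: split_prime_def)
  then have "\<Prod>S > 0" by (simp add: prod_pos)
  then show "D * (\<Prod>S)^2 > 0" using D(1) by simp
  have odd: "odd p" if "p \<in> S" for p using S(2)[OF that] by (rule odd_split_prime)
  then have "odd (\<Prod>S)" using S(1) by (simp add: even_prod_iff)
  then show "D * (\<Prod>S)^2 \<noteq> m^2" for m
    using mult_odd_square_mod_8[OF D(2)] square_mod_8_ne_5 by metis
  fix p assume p: "p \<in> S"
  then obtain t where t: "p dvd t^2 - D" using S(2) unfolding split_prime_def by blast
  have prime: "prime p" "odd p" using S(2)[OF p] odd[OF p] by (auto simp: split_prime_def)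
  define m where "m = \<Prod>(S - {p})"
  have P: "\<Prod>S = p * m" unfolding m_def using S(1) p by (simp add: prod.remove)
  have m: "odd m" unfolding m_def using S(1) odd by (simp add: even_prod_iff)
  \<comment> \<open>Adding the odd \<open>p\<close> corrects the parity: for odd \<open>c\<close>
    the difference \<open>c^2 - D * m^2\<close> is 4 modulo 8.\<close>
  define c where "c = (if odd (t * m) then t * m else t * m + p)"
  have "odd c" using prime(2) by (auto simp: c_def)
  have "c^2 - D * m^2 = (t^2 - D) * m^2 \<or> c^2 - D * m^2 = (t^2 - D) * m^2 + p * (2 * t * m + p)"
    unfolding c_def by (simp add: power2_eq_square algebra_simps)
  then have "p dvd c^2 - D * m^2" using t by auto
  moreover have "(c^2 - D * m^2) mod 8 = 4"
    using mod_diff_eq[of "c^2" 8 "D * m^2"] odd_square_mod_8[OF \<open>odd c\<close>] mult_odd_square_mod_8[OF D(2) m]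
    by simp
  then have "4 dvd c^2 - D * m^2" by presburger
  moreover have "coprime p 4"
  proof -
    have "coprime p (2^2)" using prime(2) by (simp only: coprime_power_right_iff) simp
    then show ?thesis by simp
  qed
  ultimately have "p * 4 dvd c^2 - D * m^2" by (intro divides_mult)
  then obtain d where d: "c^2 - D * m^2 = p * 4 * d" by blast
  have "Disc (Cubic 0 p c d) = p^2 * (c^2 - p * 4 * d)" by simp algebra
  also have "\<dots> = D * (\<Prod>S)^2" unfolding P d[symmetric] by algebra
  finally show "p > 0 \<and> (\<exists>c d. Disc (Cubic 0 p c d) = D * (\<Prod>S)^2)" using S0[OF p] by blast
qed

section \<open>Inert primes and simultaneous nonresidues\<close>

lemma nonresidue_mult_square:
  assumes "prime p" "nonresidue p D" "\<not> p dvd m"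
  shows "nonresidue p (D * m^2)"
  unfolding nonresidue_def using nonresidue_dvd[OF assms(1,2)] assms(3) by blast

text \<open>One prime at a time: \<open>D\<close> stays a nonresidue modulo \<open>p\<close> when
  multiplied by squares of the other primes.\<close>

lemma class_sum_inert_primes:
  assumes "finite S" "\<And>p. p \<in> S \<Longrightarrow> prime p \<and> p > 3 \<and> (\<exists>r. p dvd r^2 + 3) \<and> nonresidue p D"
  shows "class_sum (D * (\<Prod>S)^2) = class_sum D"
  using assms
proof (induction S rule: finite_induct)
  case (insert p S)
  have p: "prime p" "p > 3" "nonresidue p D" using insert by auto
  obtain r where r: "p dvd r^2 + 3" using insert by blast
  have "\<not> p dvd \<Prod>S"
  proof
    assume "p dvd \<Prod>S"
    then obtain q where "q \<in> S" "p dvd q"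
      using insert(1) p(1) prime_dvd_prod_iff[of S p "\<lambda>x. x"] by auto
    then show False using insert p(1) primes_dvd_imp_eq by (metis insertCI)
  qed
  then have nr: "nonresidue p (D * (\<Prod>S)^2)" using nonresidue_mult_square p by blast
  have "D * (\<Prod>(insert p S))^2 = D * (\<Prod>S)^2 * p^2"
    using insert(1,2) by (simp add: power_mult_distrib)
  then have "class_sum (D * (\<Prod>(insert p S))^2) = class_sum (D * (\<Prod>S)^2)"
    using class_sum_inert[OF p(1,2) r nr] by (simp only:)
  then show ?case using insert by simp
qed simp

text \<open>Squaring identifies 1 and \<open>p - 1\<close>, so it is not injective on the residues
  and misses one of them.\<close>

lemma nonresidue_exists:
  assumes "prime p" "p > (2::int)"
  shows "\<exists>g \<ge> 0. nonresidue p g"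
proof -
  let ?h = "\<lambda>x. x^2 mod p"
  have "?h 1 = ?h (p - 1)"
  proof -
    have "(p - 1)^2 = 1 + p * (p - 2)" by algebra
    then show ?thesis by (simp only: mod_mult_self2) simp
  qed
  moreover have "1 \<in> {0..<p}" "p - 1 \<in> {0..<p}" "1 \<noteq> p - 1" using assms(2) by auto
  ultimately have "\<not> inj_on ?h {0..<p}" unfolding inj_on_def by blast
  then have "?h ` {0..<p} \<noteq> {0..<p}"
    using eq_card_imp_inj_on[of "{0..<p}" ?h] by auto
  moreover have "?h ` {0..<p} \<subseteq> {0..<p}" using assms(2) by auto
  ultimately obtain g where g: "g \<in> {0..<p}" "g \<notin> ?h ` {0..<p}" by blast
  have "nonresidue p g"
    unfolding nonresidue_def
  proof (intro allI notI)
    fix x assume "p dvd x^2 - g"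
    then have "x^2 mod p = g mod p" by (simp add: mod_eq_dvd_iff)
    then have "?h (x mod p) = g" using g(1) by (simp add: power_mod)
    moreover have "x mod p \<in> {0..<p}" using assms(2) by simp
    ultimately show False using g(2) by blast
  qed
  then show ?thesis using g(1) by auto
qed

lemma nonresidue_cong:
  assumes "nonresidue p g" "p dvd D - g"
  shows "nonresidue p D"
  unfolding nonresidue_def
proof (intro allI notI)
  fix x assume "p dvd x^2 - D"
  then have "p dvd (x^2 - D) + (D - g)" using assms(2) dvd_add by blast
  then show False using assms(1) by (simp add: nonresidue_def)
qed

lemma simultaneous_nonresidue_exists:
  assumes "finite S" "\<And>p. p \<in> S \<Longrightarrow> prime p \<and> p > (2::int)"
  shows "\<exists>D > 0. D mod 8 = 5 \<and> (\<forall>p\<in>S. nonresidue p D)"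
proof -
  obtain g where g: "\<And>p. p \<in> S \<Longrightarrow> g p \<ge> 0 \<and> nonresidue p (g p)"
    using nonresidue_exists assms(2) by metis
  have S8: "8 \<notin> S"
  proof
    assume "8 \<in> S"
    then have "prime (8::int)" using assms(2) by blast
    then show False using prime_odd_int[of 8] by simp
  qed
  \<comment> \<open>The index 8 serves as an extra modulus for the Chinese remainder theorem,
    carrying the condition modulo 8.\<close>
  define u where "u p = (if p = 8 then 5 else nat (g p))" for p
  have cop8: "coprime (nat p) 8" if "p \<in> S" for p
  proof -
    have "odd p" using prime_odd_int assms(2) that by blast
    then have "odd (nat p)" using assms(2)[OF that] by (simp add: even_nat_iff)
    then have "coprime (nat p) (2^3)" by (simp only: coprime_power_right_iff) simp
    then show ?thesis by simp
  qed
  have cop: "coprime (nat p) (nat q)" if "p \<in> S" "q \<in> S" "p \<noteq> q" for p q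
  proof -
    have "prime (nat p)" "prime (nat q)"
      using assms(2)[OF that(1)] assms(2)[OF that(2)] prime_int_nat_transfer by blast+
    moreover have "p > 0" "q > 0" using assms(2)[OF that(1)] assms(2)[OF that(2)] by auto
    moreover have "nat p \<noteq> nat q" using that(3) calculation(3,4) by (simp add: eq_nat_nat_iff)
    ultimately show ?thesis using primes_coprime by blast
  qed
  have "\<forall>i\<in>insert 8 S. \<forall>j\<in>insert 8 S. i \<noteq> j \<longrightarrow> coprime (nat i) (nat j)"
    using cop cop8 by (auto simp: coprime_commute)
  then obtain x where x: "\<And>i. i \<in> insert 8 S \<Longrightarrow> [x = u i] (mod (nat i))"
    using chinese_remainder_nat[of "insert 8 S" nat u] assms(1) by (meson finite_insert)
  have "x mod 8 = 5" using x[of 8] by (simp add: u_def cong_def)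
  then have 1: "int x mod 8 = 5" by (metis of_nat_mod of_nat_numeral)
  then have 2: "int x > 0" by (cases x) auto
  have "nonresidue p (int x)" if p: "p \<in> S" for p
  proof -
    have "p \<noteq> 8" using p S8 by auto
    then have "[x = nat (g p)] (mod (nat p))" using x[of p] p by (simp add: u_def)
    then have "[int x = int (nat (g p))] (mod (int (nat p)))" by (simp only: cong_int_iff)
    then have "[int x = g p] (mod p)" using g[OF p] assms(2)[OF p] by simp
    then show ?thesis using nonresidue_cong g[OF p] unfolding cong_iff_dvd_diff by blast
  qed
  then show ?thesis using 1 2 by blast
qed

subsection \<open>The rank argument\<close>

text \<open>More vectors than coordinates are dependent, by Gaussian elimination: subtracting
  multiples of a pivot \<open>v j0\<close> clears coordinate \<open>k\<close>.\<close>

lemma linear_relation_exists: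
  fixes v :: "'a \<Rightarrow> nat \<Rightarrow> 'b :: field"
  assumes "finite J" "card J > k"
  shows "\<exists>l. (\<exists>j\<in>J. l j \<noteq> 0) \<and> (\<forall>i<k. (\<Sum>j\<in>J. l j * v j i) = 0)"
  using assms
proof (induction k arbitrary: J v)
  case 0
  then have "J \<noteq> {}" by auto
  then show ?case by (intro exI[of _ "\<lambda>_. 1"]) auto
next
  case (Suc k)
  show ?case
  proof (cases "\<forall>j\<in>J. v j k = 0")
    case True
    obtain l where "\<exists>j\<in>J. l j \<noteq> 0" "\<forall>i<k. (\<Sum>j\<in>J. l j * v j i) = 0"
      using Suc.IH[of J v] Suc.prems by auto
    moreover have "(\<Sum>j\<in>J. l j * v j k) = 0" using True by simp
    ultimately show ?thesis by (metis less_Suc_eq)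
  next
    case False
    then obtain j0 where j0: "j0 \<in> J" "v j0 k \<noteq> 0" by blast
    define J' where "J' = J - {j0}"
    define w where "w j i = v j i - v j k / v j0 k * v j0 i" for j i
    have J': "finite J'" "card J' > k" "J = insert j0 J'" "j0 \<notin> J'"
      using Suc.prems j0 by (auto simp: J'_def)
    obtain l where l: "\<exists>j\<in>J'. l j \<noteq> 0" "\<And>i. i < k \<Longrightarrow> (\<Sum>j\<in>J'. l j * w j i) = 0"
      using Suc.IH[OF J'(1,2), of w] by blast
    \<comment> \<open>The coefficient of the pivot collects the multiples subtracted in
      \<open>w\<close>.\<close>
    define l' where "l' = l(j0 := - (\<Sum>j\<in>J'. l j * v j k) / v j0 k)"
    have "(\<Sum>j\<in>J. l' j * v j i) = (\<Sum>j\<in>J'. l j * w j i)" for i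
    proof -
      have "(\<Sum>j\<in>J. l' j * v j i) = l' j0 * v j0 i + (\<Sum>j\<in>J'. l j * v j i)"
        unfolding J'(3) using J'(1,4) by (auto simp: l'_def intro!: sum.cong)
      also have "l' j0 * v j0 i = (\<Sum>j\<in>J'. - (l j * (v j k / v j0 k * v j0 i)))"
        by (simp add: l'_def sum_negf sum_distrib_right sum_divide_distrib mult.assoc)
      finally show ?thesis by (simp add: w_def right_diff_distrib sum_subtractf sum_negf)
    qed
    moreover have "(\<Sum>j\<in>J'. l j * w j k) = 0" using j0(2) by (simp add: w_def)
    ultimately have "\<forall>i<Suc k. (\<Sum>j\<in>J. l' j * v j i) = 0" using l(2) by (simp add: less_Suc_eq)
    moreover have "\<exists>j\<in>J. l' j \<noteq> 0" using l(1) J'(3,4) by (auto simp: l'_def)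
    ultimately show ?thesis by blast
  qed
qed

text \<open>The new discriminant is a nonresidue modulo all earlier primes. The new primes split for
  it and outnumber its class sum, so the diagonal entry changes; they avoid all discriminants, which
  gives the coprimality needed for multiplicativity.\<close>

lemma triangular_system_exists:
  "\<exists>(D :: nat \<Rightarrow> int) (S :: nat \<Rightarrow> int set).
    (\<forall>i<N. D i > 0 \<and> D i mod 8 = 5 \<and> finite (S i) \<and>
      (\<forall>p\<in>S i. prime p \<and> p > 3 \<and> (\<exists>r. p dvd r^2 + 3)) \<and>
      class_sum (D i * (\<Prod>(S i))^2) \<noteq> class_sum (D i)) \<and>
    (\<forall>i<N. \<forall>j<N. \<forall>p\<in>S j. \<not> p dvd D i) \<and>
    (\<forall>i<N. \<forall>j<i. \<forall>p\<in>S j. nonresidue p (D i))"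
proof (induction N)
  case (Suc N)
  then obtain D S where
    DS: "\<And>i. i < N \<Longrightarrow> D i > 0 \<and> D i mod 8 = 5 \<and> finite (S i) \<and>
      (\<forall>p\<in>S i. prime p \<and> p > 3 \<and> (\<exists>r. p dvd r^2 + 3)) \<and>
      class_sum (D i * (\<Prod>(S i))^2) \<noteq> class_sum (D i)"
    and ndvd: "\<And>i j p. i < N \<Longrightarrow> j < N \<Longrightarrow> p \<in> S j \<Longrightarrow> \<not> p dvd D i"
    and nr: "\<And>i j p. i < N \<Longrightarrow> j < i \<Longrightarrow> p \<in> S j \<Longrightarrow> nonresidue p (D i)"
    by metis
  define T where "T = (\<Union>j<N. S j)"
  have "finite T" using DS by (auto simp: T_def)
  moreover have "prime p \<and> p > 2" if p: "p \<in> T" for p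
  proof -
    obtain j where "j < N" "p \<in> S j" using p by (auto simp: T_def)
    then have "prime p" "p > 3" using DS by blast+
    then show ?thesis by simp
  qed
  ultimately obtain D' where D': "D' > 0" "D' mod 8 = 5" "\<forall>p\<in>T. nonresidue p D'"
    using simultaneous_nonresidue_exists by blast
  define M where "M = D' * (\<Prod>i<N. D i)"
  have "D i \<noteq> 0" if "i < N" for i using DS[OF that] by simp
  then have "M \<noteq> 0" using D' by (simp add: M_def)
  then obtain S' where S': "finite S'" "card S' = nat \<lceil>class_sum D'\<rceil> + 1"
      "\<And>p. p \<in> S' \<Longrightarrow> split_prime D' p \<and> \<not> p dvd M"
    using split_primes_exist[OF D'(1)] by metis
  have "class_sum D' < real (card S')" unfolding S'(2) by linarith
  also have "\<dots> \<le> class_sum (D' * (\<Prod>S')^2)"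
    using class_sum_split_primes[OF D'(1,2) S'(1)] S'(3) by blast
  finally have neq: "class_sum (D' * (\<Prod>S')^2) \<noteq> class_sum D'" by simp
  have good: "prime p \<and> p > 3 \<and> (\<exists>r. p dvd r^2 + 3)" if "p \<in> S'" for p
    using S'(3)[OF that] unfolding split_prime_def by blast
  have new_D: "nonresidue p D'" if "j < N" "p \<in> S j" for j p
    using D'(3) that by (auto simp: T_def)
  have new_S: "\<not> p dvd D'" "i < N \<Longrightarrow> \<not> p dvd D i" if "p \<in> S'" for i p
    using S'(3)[OF that] dvd_prodI[of "{..<N}" i D] dvd_trans[of p "D i" "\<Prod>i<N. D i"]
    by (auto simp: M_def)
  have 1: "(D(N := D')) i > 0 \<and> (D(N := D')) i mod 8 = 5 \<and> finite ((S(N := S')) i) \<and>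
      (\<forall>p\<in>(S(N := S')) i. prime p \<and> p > 3 \<and> (\<exists>r. p dvd r^2 + 3)) \<and>
      class_sum ((D(N := D')) i * (\<Prod>((S(N := S')) i))^2) \<noteq> class_sum ((D(N := D')) i)"
    if "i < Suc N" for i
  proof (cases "i = N")
    case True
    then show ?thesis using D'(1,2) S'(1) good neq by simp
  next
    case False
    then have "i < N" using that by simp
    then show ?thesis using DS[of i] False by simp
  qed
  have 2: "\<not> p dvd (D(N := D')) i" if "i < Suc N" "j < Suc N" "p \<in> (S(N := S')) j" for i j p
    using that ndvd[of i j p] new_S(1)[of p] new_S(2)[of p i] nonresidue_not_dvd[OF new_D[of j p]]
    by (auto simp: less_Suc_eq split: if_splits)
  have 3: "nonresidue p ((D(N := D')) i)" if "i < Suc N" "j < i" "p \<in> (S(N := S')) j" for i j p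
    using that nr[of i j p] new_D[of j p] by (auto simp: less_Suc_eq split: if_splits)
  show ?case
    by (rule exI[of _ "D(N := D')"], rule exI[of _ "S(N := S')"]) (use 1 2 3 in blast)
qed simp

theorem mainTheorem4:
  fixes C1 C2 :: real
  assumes "C1 * C2 \<noteq> 0"
  shows "\<not> (\<exists>(k::nat) (c :: nat \<Rightarrow> real) (b :: nat \<Rightarrow> nat \<Rightarrow> complex).
           k > 0 \<and> (\<forall>i\<in>{1..k}. multiplicative (b i)) \<and>
           (\<forall>n\<ge>1. complex_of_real (xi_coeff C1 C2 n) =
                    (\<Sum>i=1..k. complex_of_real (c i) * b i n)))"
proof clarify
  fix k c and b :: "nat \<Rightarrow> nat \<Rightarrow> complex"
  assume mult: "\<forall>i\<in>{1..k}. multiplicative (b i)"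
    and xi: "\<forall>n\<ge>1. complex_of_real (xi_coeff C1 C2 n) = (\<Sum>i=1..k. complex_of_real (c i) * b i n)"
  obtain D S where
    DS: "\<And>i. i < Suc k \<Longrightarrow> D i > 0 \<and> D i mod 8 = 5 \<and> finite (S i) \<and>
      (\<forall>p\<in>S i. prime p \<and> p > 3 \<and> (\<exists>r. p dvd r^2 + 3)) \<and>
      class_sum (D i * (\<Prod>(S i))^2) \<noteq> class_sum (D i)"
    and ndvd: "\<And>i j p. i < Suc k \<Longrightarrow> j < Suc k \<Longrightarrow> p \<in> S j \<Longrightarrow> \<not> p dvd D i"
    and nr: "\<And>i j p. i < Suc k \<Longrightarrow> j < i \<Longrightarrow> p \<in> S j \<Longrightarrow> nonresidue p (D i)"
    using triangular_system_exists[of "Suc k"] by metis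
  define m where "m i = nat (D i)" for i
  define n where "n j = nat ((\<Prod>(S j))^2)" for j
  have P: "odd (\<Prod>(S j))" "\<Prod>(S j) > 0" if "j < Suc k" for j
  proof -
    have "odd p \<and> p > 0" if "p \<in> S j" for p
    proof -
      have "prime p" "p > 3" using DS[OF \<open>j < Suc k\<close>] that by blast+
      then show ?thesis using prime_odd_int[of p] by simp
    qed
    then show "odd (\<Prod>(S j))" "\<Prod>(S j) > 0"
      using DS[OF that] by (auto simp: even_prod_iff intro: prod_pos)
  qed
  have xi_class: "xi_coeff C1 C2 (nat E) = C1 * class_sum E" if "E > 0" "E mod 8 = 5" for E
  proof -
    have "E mod 4 = 1" using that(2) by presburger
    then have "int (nat E mod 4) = int 1" using that(1) by (simp add: zmod_int)
    then have "nat E mod 4 = 1" by (simp only: of_nat_eq_iff)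
    then show ?thesis using xi_coeff_1_mod_4 that(1) by (simp add: class_sum_def)
  qed
  have m: "xi_coeff C1 C2 (m i) = C1 * class_sum (D i)" "m i > 0" if "i < Suc k" for i
    using xi_class DS[OF that] by (auto simp: m_def)
  have mn: "xi_coeff C1 C2 (m i * n j) = C1 * class_sum (D i * (\<Prod>(S j))^2)" "n j > 0"
    if "i < Suc k" "j < Suc k" for i j
  proof -
    have "m i * n j = nat (D i * (\<Prod>(S j))^2)" using DS[OF that(1)] by (simp add: m_def n_def nat_mult_distrib)
    moreover have "D i * (\<Prod>(S j))^2 > 0" using DS[OF that(1)] P[OF that(2)] by simp
    moreover have "D i * (\<Prod>(S j))^2 mod 8 = 5"
      using DS[OF that(1)] P[OF that(2)] mult_odd_square_mod_8 by blast
    ultimately show "xi_coeff C1 C2 (m i * n j) = C1 * class_sum (D i * (\<Prod>(S j))^2)"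
      using xi_class by simp
    show "n j > 0" using P(2)[OF that(2)] by (simp add: n_def)
  qed
  have coprime: "coprime (m i) (n j)" if "i < Suc k" "j < Suc k" for i j
  proof -
    have "coprime (D i) p" if "p \<in> S j" for p
    proof -
      have "prime p" using DS[OF \<open>j < Suc k\<close>] that by blast
      then show ?thesis
        using ndvd[OF \<open>i < Suc k\<close> \<open>j < Suc k\<close> that] prime_imp_coprime by (metis coprime_commute)
    qed
    then have "coprime (D i) ((\<Prod>(S j))^2)" by (simp add: prod_coprime_right)
    then have "coprime (int (m i)) (int (n j))" using DS[OF that(1)] by (simp add: m_def n_def)
    then show ?thesis by simp
  qed
  \<comment> \<open>Multiplicativity makes \<open>jump\<close> a sum of \<open>k\<close> products of
    a function of \<open>i\<close> and a function of \<open>j\<close>: a matrix of size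
    \<open>k + 1\<close> and rank at most \<open>k\<close>.\<close>
  define jump where "jump i j = complex_of_real (xi_coeff C1 C2 (m i * n j) - xi_coeff C1 C2 (m i))" for i j
  have jump: "jump i j = (\<Sum>t=1..k. c t * b t (m i) * (b t (n j) - 1))" if "i < Suc k" "j < Suc k" for i j
  proof -
    have "b t (m i * n j) = b t (m i) * b t (n j)" if "t \<in> {1..k}" for t
      using mult that m(2) mn(2) coprime \<open>i < Suc k\<close> \<open>j < Suc k\<close> by (simp add: multiplicative_def)
    moreover have "m i \<ge> 1" "m i * n j \<ge> 1" using m(2)[OF that(1)] mn(2)[OF that] by simp_all
    ultimately show ?thesis
      using xi by (simp add: jump_def right_diff_distrib sum_subtractf mult.assoc)
  qed
  have diag: "jump i i \<noteq> 0" if "i < Suc k" for i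
    using m(1)[OF that] mn(1)[OF that that] DS[OF that] assms by (simp add: jump_def)
  have lower: "jump i j = 0" if "i < Suc k" "j < i" for i j
  proof -
    have j: "j < Suc k" using that by simp
    then have "class_sum (D i * (\<Prod>(S j))^2) = class_sum (D i)"
      using class_sum_inert_primes[of "S j" "D i"] DS[OF j] nr[OF that] by blast
    then show ?thesis using m(1)[OF that(1)] mn(1)[OF that(1) j] by (simp add: jump_def)
  qed
  \<comment> \<open>A relation among the \<open>k + 1\<close> columns; \<open>Suc t\<close> shifts
    the coordinates to the index range \<open>{1..k}\<close>.\<close>
  obtain l where l: "\<exists>j\<in>{..<Suc k}. l j \<noteq> 0"
      "\<And>t. t < k \<Longrightarrow> (\<Sum>j<Suc k. l j * (b (Suc t) (n j) - 1)) = 0"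
    using linear_relation_exists[of "{..<Suc k}" k "\<lambda>j t. b (Suc t) (n j) - 1"] by auto
  define i where "i = Max {j \<in> {..<Suc k}. l j \<noteq> 0}"
  have "i \<in> {j \<in> {..<Suc k}. l j \<noteq> 0}" unfolding i_def using l(1) by (intro Max_in) auto
  then have i: "i < Suc k" "l i \<noteq> 0" by auto
  have above: "l j = 0" if "j < Suc k" "j > i" for j
    using that Max_ge[of "{j \<in> {..<Suc k}. l j \<noteq> 0}" j] unfolding i_def by fastforce
  \<comment> \<open>In row \<open>i\<close>, \<open>lower\<close> kills the columns before
    \<open>i\<close> and \<open>above\<close> those after it, so only the diagonal term
    survives.\<close>
  have "(\<Sum>j<Suc k. l j * jump i j) = (\<Sum>j<Suc k. if j = i then l i * jump i i else 0)"
  proof (intro sum.cong refl)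
    fix j assume "j \<in> {..<Suc k}"
    then show "l j * jump i j = (if j = i then l i * jump i i else 0)"
      using above[of j] lower[OF i(1), of j] by (cases j i rule: linorder_cases) auto
  qed
  also have "\<dots> = l i * jump i i" using i(1) by (simp only: sum.delta finite_lessThan lessThan_iff if_True)
  finally have "(\<Sum>j<Suc k. l j * jump i j) = l i * jump i i" .
  moreover have "(\<Sum>j<Suc k. l j * jump i j)
      = (\<Sum>j<Suc k. \<Sum>t=1..k. c t * b t (m i) * (l j * (b t (n j) - 1)))"
    using jump[OF i(1)] by (intro sum.cong refl) (simp add: sum_distrib_left mult_ac)
  also have "\<dots> = (\<Sum>t=1..k. c t * b t (m i) * (\<Sum>j<Suc k. l j * (b t (n j) - 1)))"
    by (subst sum.swap) (simp only: sum_distrib_left)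
  also have "\<dots> = 0"
  proof (intro sum.neutral ballI)
    fix t assume "t \<in> {1..k}"
    then have "t - 1 < k" "Suc (t - 1) = t" by auto
    then have "(\<Sum>j<Suc k. l j * (b t (n j) - 1)) = 0" using l(2)[of "t - 1"] by (simp only:)
    then show "c t * b t (m i) * (\<Sum>j<Suc k. l j * (b t (n j) - 1)) = 0"
      by (simp only: mult_zero_right)
  qed
  finally show False using i diag by simp
qed

end
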